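(* Let $\bm m=(m_1,m_2,m_3)\in\mathbb R^3$, $\lambda>0$, and $$\tilde S=\begin{bmatrix}0&-m_3&m_2&m_1\\ m_3&0&-m_1&m_2\\ -m_2&m_1&0&m_3\\ -m_1&-m_2&-m_3&0\end{bmatrix}.$$ Then $\tilde S^2=-\|\bm m\|_2^2I$, $(\lambda I+\tilde S)^T(\lambda I+\tilde S)=(\lambda^2+\|\bm m\|_2^2)I$, so that $\kappa_2(\lambda I+\tilde S)=1$ and $\|(\lambda I+\tilde S)^{-1}\|_2=(\lambda^2+\|\bm m\|_2^2)^{-1/2}$, and, with $p_j=m_j/\lambda$, $$(\lambda I+\tilde S)^{-1}=\frac{\lambda I-\tilde S}{\lambda^2+\|\bm m\|_2^2}=\frac1{\lambda(p_1^2+p_2^2+p_3^2+1)}\begin{bmatrix} 1 & p_3 & -p_2 & -p_1 \\ -p_3 & 1 & p_1 & -p_2 \\ {p_2} & -p_1 & 1 & -p_3 \\ {p_1} & p_2 & p_3 & 1 \end{bmatrix}.$$ Consequently, on a periodic grid with $N_g$ nodes, the inverse of the preconditioner $\mathcal M_\lambda=(\mathcal H+\lambda\mathcal I)(\mathcal S+\lambda\mathcal I)$, with $\mathcal H$ and $\mathcal S$ as defined in the context, can be applied to a vector, without assembling a global matrix or factorizing local blocks, using $O(N_g\log N_g)$ arithmetic operations and $O(N_g)$ temporary storage: the factor $(\mathcal H+\lambda\mathcal I)^{-1}$ by FFTs and division of each Fourier coefficient at $\bm\xi$ of the velocity part by $\alpha+\theta k\widehat C_{\rm exc}|\bm\xi|^2+\lambda$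 (and of the multiplier part by $\lambda$), and the factor $(\mathcal S+\lambda\mathcal I)^{-1}$ by applying, at each node $i$, the closed-form $4\times4$ inverse $(\lambda I+\tilde S_i)^{-1}=(\lambda I-\tilde S_i)/(\lambda^2+\|\bm m_i\|_2^2)$, where $\tilde S_i$ denotes the matrix $\tilde S$ with $\bm m=\bm m_i$.
   Context: Uniform periodic Cartesian grid on $\prod_{\ell=1}^d(0,L_\ell)$ with $N_g$ nodes; discrete Fourier wave vectors $\bm\xi$; $-\Delta_N$ is the operator multiplying the discrete Fourier coefficient at $\bm\xi$ by $|\bm\xi|^2$. Let $\alpha,k,\widehat C_{\rm exc},\lambda>0$, $\theta\in\{1,\frac12\}$. Vectors are $(\bm v,\bm r)$ with $\bm v\in\mathbb R^{3N_g}$ (an $\mathbb R^3$-valued grid function) and $\bm r\in\mathbb R^{N_g}$. $H$ is the matrix of $\alpha I+\theta k\widehat C_{\rm exc}(-\Delta_N)$ applied componentwise. Given nodal vectors $\bm m_i\in\mathbb R^3$, $S$ is block diagonal with blocks $\bm a\mapsto\bm m_i\times\bm a$, and $B$ is block diagonal with $1\times3$ blocks $\bm m_i^T$. Set $\mathcal H=\begin{bmatrix}H&0\\0&0\end{bmatrix}$, $\mathcal S=\begin{bmatrix}S&B^T\\-B&0\end{bmatrix}$. Grouping the three velocity components and the multiplier at each node turns $\mathcal S$ into a block diagonal matrix whose $i$-th $4\times4$ block is the matrix $\tilde S$ of the claim with $\bm m=\bm m_i$. $\kappa_2$ is the spectral condition number. The cost count is in the standard arithmetic-operation model, with an FFT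 of $N_g$ points costing $O(N_g\log N_g)$ operations. *)

theory Defs
  imports
    "HOL-Analysis.Analysis"
    "HOL-Library.Landau_Symbols"
    "Jordan_Normal_Form.Gauss_Jordan_Elimination"
begin

no_notation vec_index (infixl \<open>$\<close> 100)
notation vec_index (infixl \<open>$\<^sub>v\<close> 100)

hide_const (open) Matrix.mat Matrix.vec
hide_type (open) Matrix.vec Matrix.mat

section \<open>The local block\<close>

definition S_tilde :: "real^3 \<Rightarrow> real^4^4" where
  "S_tilde m = vector
     [vector [0, - (m$3), m$2, m$1],
      vector [m$3, 0, - (m$1), m$2],
      vector [- (m$2), m$1, 0, m$3],
      vector [- (m$1), - (m$2), - (m$3), 0]]"

definition spectral_norm :: "real^'n^'m \<Rightarrow> real" where
  "spectral_norm A = onorm ((*v) A)"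

definition kappa\<^sub>2 :: "real^'n^'n \<Rightarrow> real" where
  "kappa\<^sub>2 A = spectral_norm A * spectral_norm (matrix_inv A)"


section \<open>The periodic grid and its Fourier modes\<close>

text \<open>
  A grid is given by the list \<open>ns\<close> of the numbers of nodes and the list \<open>Ls\<close> of the
  periods in the coordinate directions. Nodes and Fourier modes are both numbered by
  \<open>{..<Ng ns}\<close>; \<open>digit ns l j\<close> is the \<open>l\<close>-th entry of the multi-index with number \<open>j\<close>.
\<close>

definition periodic_grid :: "nat \<Rightarrow> nat list \<Rightarrow> real list \<Rightarrow> bool" where
  "periodic_grid d ns Ls \<longleftrightarrow>
     length ns = d \<and> length Ls = d \<and> (\<forall>n\<in>set ns. 0 < n) \<and> (\<forall>L\<in>set Ls. 0 < L)"

definition Ng :: "nat list \<Rightarrow> nat" where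
  "Ng ns = prod_list ns"

definition digit :: "nat list \<Rightarrow> nat \<Rightarrow> nat \<Rightarrow> nat" where
  "digit ns l j = (j div prod_list (take l ns)) mod (ns ! l)"

definition node :: "nat list \<Rightarrow> real list \<Rightarrow> nat \<Rightarrow> nat \<Rightarrow> real" where
  "node ns Ls j l = real (digit ns l j) * (Ls ! l) / real (ns ! l)"

text \<open>For even \<open>n\<close> the unpaired mode gets the wave number \<open>-n/2\<close>.\<close>

definition wavenum :: "nat list \<Rightarrow> nat \<Rightarrow> nat \<Rightarrow> int" where
  "wavenum ns q l =
     (if 2 * digit ns l q < ns ! l then int (digit ns l q) else int (digit ns l q) - int (ns ! l))"

definition wave_vector :: "nat list \<Rightarrow> real list \<Rightarrow> nat \<Rightarrow> nat \<Rightarrow> real" where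
  "wave_vector ns Ls q l = 2 * pi * of_int (wavenum ns q l) / (Ls ! l)"

definition wave_norm_sq :: "nat list \<Rightarrow> real list \<Rightarrow> nat \<Rightarrow> real" where
  "wave_norm_sq ns Ls q = (\<Sum>l<length ns. (wave_vector ns Ls q l)\<^sup>2)"

text \<open>\<open>phase ns q j\<close> is the inner product of wave vector \<open>q\<close> with node \<open>j\<close>; the periods cancel.\<close>

definition phase :: "nat list \<Rightarrow> nat \<Rightarrow> nat \<Rightarrow> real" where
  "phase ns q j =
     (\<Sum>l<length ns. 2 * pi * of_int (wavenum ns q l) * real (digit ns l j) / real (ns ! l))"

lemma phase_eq_inner:
  assumes "periodic_grid d ns Ls"
  shows "phase ns q j = (\<Sum>l<d. wave_vector ns Ls q l * node ns Ls j l)"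
proof -
  have "Ls ! l \<noteq> 0" if "l < d" for l
    using assms that unfolding periodic_grid_def by (metis less_irrefl nth_mem)
  then show ?thesis
    using assms
    by (auto simp: phase_def wave_vector_def node_def periodic_grid_def intro!: sum.cong)
qed

definition dft :: "nat list \<Rightarrow> (nat \<Rightarrow> complex) \<Rightarrow> nat \<Rightarrow> complex" where
  "dft ns u q = (\<Sum>j<Ng ns. u j * cis (- phase ns q j))"

definition idft :: "nat list \<Rightarrow> (nat \<Rightarrow> complex) \<Rightarrow> nat \<Rightarrow> complex" where
  "idft ns u j = (\<Sum>q<Ng ns. u q * cis (phase ns q j)) / of_nat (Ng ns)"


section \<open>The global matrices\<close>

text \<open>
  Column \<open>j\<close> is the multiplier operator applied to the \<open>j\<close>-th nodal unit vector. The
  result is real because \<open>wave_norm_sq\<close> agrees on conjugate modes, so \<open>Re\<close> is only a coercion.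
\<close>

definition neg_laplacian :: "nat list \<Rightarrow> real list \<Rightarrow> real Matrix.mat" where
  "neg_laplacian ns Ls = Matrix.mat (Ng ns) (Ng ns) (\<lambda>(i, j).
     Re (idft ns (\<lambda>q. of_real (wave_norm_sq ns Ls q) * dft ns (\<lambda>i. if i = j then 1 else 0) q) i))"

text \<open>
  In the vector \<open>(v, r)\<close> of length \<open>4 * N\<close>, entry \<open>3 * i + c\<close> is component \<open>c\<close> (counted
  from 0) of the velocity at node \<open>i\<close>, and entry \<open>3 * N + i\<close> is the multiplier there.
  In the index type \<open>3\<close> the components are counted from 1.
\<close>

definition entry :: "nat \<Rightarrow> nat \<Rightarrow> nat \<Rightarrow> nat" where
  "entry N c i = (if c < 3 then 3 * i + c else 3 * N + i)"

definition node_vec :: "nat \<Rightarrow> real Matrix.vec \<Rightarrow> nat \<Rightarrow> real^4" where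
  "node_vec N y i =
     vector [y $\<^sub>v entry N 0 i, y $\<^sub>v entry N 1 i, y $\<^sub>v entry N 2 i, y $\<^sub>v entry N 3 i]"

definition comp3 :: "nat \<Rightarrow> 3" where
  "comp3 c = of_nat (Suc c)"

definition H_mat :: "nat list \<Rightarrow> real list \<Rightarrow> real \<Rightarrow> real \<Rightarrow> real \<Rightarrow> real \<Rightarrow> real Matrix.mat" where
  "H_mat ns Ls \<alpha> \<theta> k Cexc =
     (let A = \<alpha> \<cdot>\<^sub>m 1\<^sub>m (Ng ns) + (\<theta> * k * Cexc) \<cdot>\<^sub>m neg_laplacian ns Ls
      in Matrix.mat (3 * Ng ns) (3 * Ng ns)
           (\<lambda>(r, s). if r mod 3 = s mod 3 then A $$ (r div 3, s div 3) else 0))"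

definition S_mat :: "nat \<Rightarrow> (nat \<Rightarrow> real^3) \<Rightarrow> real Matrix.mat" where
  "S_mat N ms = Matrix.mat (3 * N) (3 * N) (\<lambda>(r, s).
     if r div 3 = s div 3
     then cross3 (ms (r div 3)) (axis (comp3 (s mod 3)) 1) $ comp3 (r mod 3) else 0)"

definition B_mat :: "nat \<Rightarrow> (nat \<Rightarrow> real^3) \<Rightarrow> real Matrix.mat" where
  "B_mat N ms = Matrix.mat N (3 * N) (\<lambda>(i, s). if i = s div 3 then ms i $ comp3 (s mod 3) else 0)"

definition calH :: "nat list \<Rightarrow> real list \<Rightarrow> real \<Rightarrow> real \<Rightarrow> real \<Rightarrow> real \<Rightarrow> real Matrix.mat" where
  "calH ns Ls \<alpha> \<theta> k Cexc =
     (let N = Ng ns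
      in four_block_mat (H_mat ns Ls \<alpha> \<theta> k Cexc) (0\<^sub>m (3 * N) N) (0\<^sub>m N (3 * N)) (0\<^sub>m N N))"

definition calS :: "nat \<Rightarrow> (nat \<Rightarrow> real^3) \<Rightarrow> real Matrix.mat" where
  "calS N ms =
     four_block_mat (S_mat N ms) (transpose_mat (B_mat N ms)) (- B_mat N ms) (0\<^sub>m N N)"

definition shifted :: "real \<Rightarrow> real Matrix.mat \<Rightarrow> real Matrix.mat" where
  "shifted lam A = A + lam \<cdot>\<^sub>m 1\<^sub>m (dim_row A)"

definition precond ::
  "nat list \<Rightarrow> real list \<Rightarrow> real \<Rightarrow> real \<Rightarrow> real \<Rightarrow> real \<Rightarrow> (nat \<Rightarrow> real^3) \<Rightarrow> real \<Rightarrow> real Matrix.mat" where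
  "precond ns Ls \<alpha> \<theta> k Cexc ms lam =
     shifted lam (calH ns Ls \<alpha> \<theta> k Cexc) * shifted lam (calS (Ng ns) ms)"


section \<open>The arithmetic-operation model\<close>

text \<open>
  Straight-line programs over memory cells, addressed by an array name and an index and
  holding exact numbers. Real data are embedded in the complex numbers, and a complex
  operation is charged like a real one, which changes counts by a constant factor only.
  A program can contain integer literals only: all real data must be read from memory.
\<close>

datatype array =
    Alpha | Theta | K | Cex | Lam | TwoPi  \<comment> \<open>input scalars, in cell 0\<close>
  | Len            \<comment> \<open>input: periods\<close>
  | Mag nat        \<comment> \<open>input: components of the nodal vectors\<close>
  | Rhs nat        \<comment> \<open>input: three velocity components, then the multiplier\<close>
  | Aux nat        \<comment> \<open>vector after the first factor, laid out as \<open>Rhs\<close>\<close>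
  | Sol nat        \<comment> \<open>output, laid out as \<open>Rhs\<close>\<close>
  | Tmp nat        \<comment> \<open>scratch scalars, in cell 0\<close>

type_synonym cell = "array \<times> nat"
type_synonym state = "cell \<Rightarrow> complex"

datatype arith = Plus | Minus | Times | Divide

datatype instr =
    Lit cell int
  | Op cell cell arith cell  \<comment> \<open>target, left operand, operation, right operand\<close>
  | Fft array array          \<comment> \<open>target, source\<close>
  | Ifft array array

fun arith_sem :: "arith \<Rightarrow> complex \<Rightarrow> complex \<Rightarrow> complex" where
  "arith_sem Plus x y = x + y"
| "arith_sem Minus x y = x - y"
| "arith_sem Times x y = x * y"
| "arith_sem Divide x y = x / y"

definition store_array :: "nat \<Rightarrow> array \<Rightarrow> (nat \<Rightarrow> complex) \<Rightarrow> state \<Rightarrow> state" where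
  "store_array N a u s = (\<lambda>(b, i). if b = a \<and> i < N then u i else s (b, i))"

fun exec :: "nat list \<Rightarrow> instr \<Rightarrow> state \<Rightarrow> state" where
  "exec ns (Lit x z) s = s(x := of_int z)"
| "exec ns (Op x y f z) s = s(x := arith_sem f (s y) (s z))"
| "exec ns (Fft a b) s = store_array (Ng ns) a (dft ns (\<lambda>j. s (b, j))) s"
| "exec ns (Ifft a b) s = store_array (Ng ns) a (idft ns (\<lambda>j. s (b, j))) s"

definition run :: "nat list \<Rightarrow> instr list \<Rightarrow> state \<Rightarrow> state" where
  "run ns prog s = fold (exec ns) prog s"

text \<open>\<open>F N\<close> operations and \<open>W N\<close> cells of private workspace are charged for a transform of \<open>N\<close> points.\<close>

fun instr_ops :: "(nat \<Rightarrow> nat) \<Rightarrow> nat \<Rightarrow> instr \<Rightarrow> nat" where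
  "instr_ops F N (Fft a b) = F N"
| "instr_ops F N (Ifft a b) = F N"
| "instr_ops F N (Lit x z) = 1"
| "instr_ops F N (Op x y f z) = 1"

definition ops :: "(nat \<Rightarrow> nat) \<Rightarrow> nat \<Rightarrow> instr list \<Rightarrow> nat" where
  "ops F N prog = sum_list (map (instr_ops F N) prog)"

fun instr_writes :: "nat \<Rightarrow> instr \<Rightarrow> cell set" where
  "instr_writes N (Fft a b) = {a} \<times> {..<N}"
| "instr_writes N (Ifft a b) = {a} \<times> {..<N}"
| "instr_writes N (Lit x z) = {x}"
| "instr_writes N (Op x y f z) = {x}"

fun instr_workspace :: "(nat \<Rightarrow> nat) \<Rightarrow> nat \<Rightarrow> instr \<Rightarrow> nat" where
  "instr_workspace W N (Fft a b) = W N"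
| "instr_workspace W N (Ifft a b) = W N"
| "instr_workspace W N (Lit x z) = 0"
| "instr_workspace W N (Op x y f z) = 0"

text \<open>All cells a program writes are charged, including those holding the output. Transform
  workspace can be reused, so it is charged once.\<close>

definition storage :: "(nat \<Rightarrow> nat) \<Rightarrow> nat \<Rightarrow> instr list \<Rightarrow> nat" where
  "storage W N prog =
     card (\<Union>ins\<in>set prog. instr_writes N ins) + Max (insert 0 (instr_workspace W N ` set prog))"


section \<open>Applying the inverse preconditioner\<close>

abbreviation tmp :: "nat \<Rightarrow> cell" where "tmp a \<equiv> (Tmp a, 0)"

text \<open>Leaves the symbol of \<open>calH + lam I\<close> on the velocity part at mode \<open>q\<close> in \<open>tmp 2\<close>, given
  \<open>alpha + lam\<close> in \<open>tmp 0\<close> and \<open>theta k Cexc\<close> in \<open>tmp 1\<close>.\<close>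

definition symbol_prog :: "nat list \<Rightarrow> nat \<Rightarrow> instr list" where
  "symbol_prog ns q =
     [Lit (tmp 2) 0]
     @ concat (map (\<lambda>l.
         [Lit (tmp 3) (wavenum ns q l),
          Op (tmp 3) (tmp 3) Times (TwoPi, 0),
          Op (tmp 3) (tmp 3) Divide (Len, l),
          Op (tmp 3) (tmp 3) Times (tmp 3),
          Op (tmp 2) (tmp 2) Plus (tmp 3)]) [0..<length ns])
     @ [Op (tmp 2) (tmp 2) Times (tmp 1),
        Op (tmp 2) (tmp 2) Plus (tmp 0)]"

definition H_solve :: "nat list \<Rightarrow> instr list" where
  "H_solve ns =
     [Op (tmp 0) (Alpha, 0) Plus (Lam, 0),
      Op (tmp 1) (Theta, 0) Times (K, 0),
      Op (tmp 1) (tmp 1) Times (Cex, 0),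
      Fft (Aux 0) (Rhs 0), Fft (Aux 1) (Rhs 1), Fft (Aux 2) (Rhs 2)]
     @ concat (map (\<lambda>q.
         symbol_prog ns q
         @ [Op (Aux 0, q) (Aux 0, q) Divide (tmp 2),
            Op (Aux 1, q) (Aux 1, q) Divide (tmp 2),
            Op (Aux 2, q) (Aux 2, q) Divide (tmp 2)]) [0..<Ng ns])
     @ [Ifft (Aux 0) (Aux 0), Ifft (Aux 1) (Aux 1), Ifft (Aux 2) (Aux 2)]
     @ map (\<lambda>i. Op (Aux 3, i) (Rhs 3, i) Divide (Lam, 0)) [0..<Ng ns]"

definition add_product :: "cell \<Rightarrow> arith \<Rightarrow> cell \<Rightarrow> cell \<Rightarrow> instr list" where
  "add_product x f y z = [Op (tmp 1) y Times z, Op x x f (tmp 1)]"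

text \<open>At node \<open>i\<close>, the rows of \<open>(lam I - S_tilde m) / (lam\<^sup>2 + |m|\<^sup>2)\<close> applied to \<open>Aux\<close>.\<close>

definition node_solve :: "nat \<Rightarrow> instr list" where
  "node_solve i =
     (let lam = (Lam, 0); m1 = (Mag 0, i); m2 = (Mag 1, i); m3 = (Mag 2, i);
          y0 = (Aux 0, i); y1 = (Aux 1, i); y2 = (Aux 2, i); y3 = (Aux 3, i);
          x0 = (Sol 0, i); x1 = (Sol 1, i); x2 = (Sol 2, i); x3 = (Sol 3, i)
      in [Op (tmp 0) lam Times lam]
         @ add_product (tmp 0) Plus m1 m1 @ add_product (tmp 0) Plus m2 m2
         @ add_product (tmp 0) Plus m3 m3
         @ [Op x0 lam Times y0]
         @ add_product x0 Plus m3 y1 @ add_product x0 Minus m2 y2 @ add_product x0 Minus m1 y3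
         @ [Op x0 x0 Divide (tmp 0)]
         @ [Op x1 lam Times y1]
         @ add_product x1 Minus m3 y0 @ add_product x1 Plus m1 y2 @ add_product x1 Minus m2 y3
         @ [Op x1 x1 Divide (tmp 0)]
         @ [Op x2 lam Times y2]
         @ add_product x2 Plus m2 y0 @ add_product x2 Minus m1 y1 @ add_product x2 Minus m3 y3
         @ [Op x2 x2 Divide (tmp 0)]
         @ [Op x3 lam Times y3]
         @ add_product x3 Plus m1 y0 @ add_product x3 Plus m2 y1 @ add_product x3 Plus m3 y2
         @ [Op x3 x3 Divide (tmp 0)])"

definition S_solve :: "nat \<Rightarrow> instr list" where
  "S_solve N = concat (map node_solve [0..<N])"

definition precond_solve :: "nat list \<Rightarrow> instr list" where
  "precond_solve ns = H_solve ns @ S_solve (Ng ns)"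

definition loaded ::
  "nat list \<Rightarrow> real list \<Rightarrow> real \<Rightarrow> real \<Rightarrow> real \<Rightarrow> real \<Rightarrow> (nat \<Rightarrow> real^3) \<Rightarrow> real
   \<Rightarrow> real Matrix.vec \<Rightarrow> state \<Rightarrow> bool" where
  "loaded ns Ls \<alpha> \<theta> k Cexc ms lam b s \<longleftrightarrow>
     s (Alpha, 0) = of_real \<alpha> \<and> s (Theta, 0) = of_real \<theta> \<and> s (K, 0) = of_real k \<and>
     s (Cex, 0) = of_real Cexc \<and> s (Lam, 0) = of_real lam \<and> s (TwoPi, 0) = of_real (2 * pi) \<and>
     (\<forall>l<length ns. s (Len, l) = of_real (Ls ! l)) \<and>
     (\<forall>i<Ng ns. \<forall>c<3. s (Mag c, i) = of_real (ms i $ comp3 c)) \<and>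
     (\<forall>i<Ng ns. \<forall>c<4. s (Rhs c, i) = of_real (b $\<^sub>v entry (Ng ns) c i))"

definition holds :: "nat \<Rightarrow> (nat \<Rightarrow> array) \<Rightarrow> real Matrix.vec \<Rightarrow> state \<Rightarrow> bool" where
  "holds N a y s \<longleftrightarrow> (\<forall>i<N. \<forall>c<4. s (a c, i) = of_real (y $\<^sub>v entry N c i))"

end

theory Submission
  imports Defs "HOL-Number_Theory.Cong" "Jordan_Normal_Form.Determinant"
begin

text \<open>
  The block \<open>S_tilde m\<close> is skew-symmetric with square \<open>- |m|\<^sup>2 I\<close>, so \<open>lam I + S_tilde m\<close> is a
  scaled orthogonal matrix with inverse \<open>(lam I - S_tilde m) / (lam\<^sup>2 + |m|\<^sup>2)\<close>. Sums over the grid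
  of products over the coordinate directions factorize into one-dimensional sums. This gives the
  orthogonality of the Fourier modes. It also shows that the kernel of the discrete Laplacian is
  real: its symbol is a sum of one-dimensional symbols, each invariant under \<open>a \<mapsto> (n - a) mod n\<close>.
  Both factors of the preconditioner are injective, because the image of a vector determines each
  of its Fourier modes, respectively the four entries at each node; hence they are invertible,
  and the same computation identifies the inverses. Each loop body of the program writes only
  scratch cells and cells of its own index, so the final value of a cell is the one left by the
  iteration with that index.
\<close>

(* Merging the imported theory with Defs makes these names and this notation visible again. *)
no_notation vec_index (infixl \<open>$\<close> 100)
hide_const (open) Matrix.mat Matrix.vec
hide_type (open) Matrix.vec Matrix.mat

section \<open>The local block\<close>

lemma norm_mult_self_3: "norm m * norm m = m$1 * m$1 + m$2 * m$2 + m$3 * m$3" for m :: "real^3"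
  unfolding power2_eq_square[symmetric] power2_norm_eq_inner
  by (simp add: Finite_Cartesian_Product.inner_vec_def sum_3 power2_eq_square)

lemma vector_4:
  "(vector [a, b, c, e] :: 'a::zero^4) $ 1 = a" "(vector [a, b, c, e] :: 'a^4) $ 2 = b"
  "(vector [a, b, c, e] :: 'a^4) $ 3 = c" "(vector [a, b, c, e] :: 'a^4) $ 4 = e"
  by (simp_all add: vector_def)

lemma S_tilde_rows [simp]:
  "S_tilde m $ 1 $ 1 = 0" "S_tilde m $ 1 $ 2 = - (m$3)" "S_tilde m $ 1 $ 3 = m$2" "S_tilde m $ 1 $ 4 = m$1"
  "S_tilde m $ 2 $ 1 = m$3" "S_tilde m $ 2 $ 2 = 0" "S_tilde m $ 2 $ 3 = - (m$1)" "S_tilde m $ 2 $ 4 = m$2"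
  "S_tilde m $ 3 $ 1 = - (m$2)" "S_tilde m $ 3 $ 2 = m$1" "S_tilde m $ 3 $ 3 = 0" "S_tilde m $ 3 $ 4 = m$3"
  "S_tilde m $ 4 $ 1 = - (m$1)" "S_tilde m $ 4 $ 2 = - (m$2)" "S_tilde m $ 4 $ 3 = - (m$3)" "S_tilde m $ 4 $ 4 = 0"
  by (simp_all add: S_tilde_def vector_4)

text \<open>Acting on \<open>(v, r)\<close>, the block is left multiplication by the purely
  imaginary quaternion with vector part \<open>m\<close>, and such a quaternion squares to minus its
  squared norm. The proof compares the sixteen entries.\<close>

lemma S_tilde_square: "S_tilde m ** S_tilde m = - ((norm m)\<^sup>2 *\<^sub>R mat 1)"
  by (simp add: Finite_Cartesian_Product.vec_eq_iff forall_4 matrix_matrix_mult_def sum_4 Finite_Cartesian_Product.mat_def norm_mult_self_3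
      power2_eq_square algebra_simps)

lemma transpose_shifted_S_tilde:
  "transpose (lam *\<^sub>R mat 1 + S_tilde m) = lam *\<^sub>R mat 1 - S_tilde m"
  by (simp add: Finite_Cartesian_Product.vec_eq_iff forall_4 transpose_def Finite_Cartesian_Product.mat_def)

text \<open>A difference of squares, since the two factors commute. By skew-symmetry the first
  product is the Gram matrix of the shifted block and the second that of its transpose; together
  they give a two-sided inverse.\<close>

lemma shifted_S_tilde_products:
  "(lam *\<^sub>R mat 1 - S_tilde m) ** (lam *\<^sub>R mat 1 + S_tilde m) = (lam\<^sup>2 + (norm m)\<^sup>2) *\<^sub>R mat 1"
  "(lam *\<^sub>R mat 1 + S_tilde m) ** (lam *\<^sub>R mat 1 - S_tilde m) = (lam\<^sup>2 + (norm m)\<^sup>2) *\<^sub>R mat 1"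
  by (simp_all add: Finite_Cartesian_Product.vec_eq_iff forall_4 matrix_matrix_mult_def sum_4 Finite_Cartesian_Product.mat_def norm_mult_self_3
      power2_eq_square algebra_simps)

text \<open>A scalar Gram matrix means that every vector is stretched by the same factor
  \<open>sqrt c\<close>, so the operator norm is attained at any unit vector. This serves for the
  shifted block and for its inverse.\<close>

lemma spectral_norm_scaled_isometry:
  fixes A :: "real^'n^'m"
  assumes "transpose A ** A = c *\<^sub>R mat 1" "0 \<le> c"
  shows "spectral_norm A = sqrt c"
proof -
  have norm_A: "norm (A *v x) = sqrt c * norm x" for x
  proof -
    have "(norm (A *v x))\<^sup>2 = x \<bullet> (transpose A *v (A *v x))"
      by (metis dot_lmul_matrix power2_norm_eq_inner transpose_matrix_vector inner_commute)
    also have "\<dots> = c * (norm x)\<^sup>2"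
      by (simp add: matrix_vector_mul_assoc assms power2_norm_eq_inner flip: scaleR_matrix_vector_assoc)
    finally show ?thesis
      using assms(2) by (metis norm_ge_zero real_sqrt_mult real_sqrt_abs abs_of_nonneg)
  qed
  obtain x :: "real^'n" where x: "norm x = 1"
    using vector_choose_size[of 1] by auto
  show ?thesis
    unfolding spectral_norm_def
  proof (rule antisym)
    show "onorm ((*v) A) \<le> sqrt c"
      using assms(2) by (intro onorm_bound) (simp_all add: norm_A)
    show "sqrt c \<le> onorm ((*v) A)"
      using onorm[OF matrix_vector_mul_bounded_linear[of A], of x] by (simp add: norm_A x)
  qed
qed

text \<open>\<open>matrix_inv\<close> is a choice operator: \<open>B\<close> is first the witness
  that the chosen matrix is a two-sided inverse, and uniqueness of inverses then identifies the
  two.\<close>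

lemma matrix_inv_eqI:
  assumes "A ** B = mat 1" "B ** A = mat 1"
  shows "matrix_inv A = B"
proof -
  have "A ** matrix_inv A = mat 1 \<and> matrix_inv A ** A = mat 1"
    unfolding matrix_inv_def by (rule someI[of _ B]) (use assms in simp)
  then show ?thesis
    by (metis assms(1) matrix_mul_assoc matrix_mul_lid matrix_mul_rid assms(2))
qed

lemma matrix_mult_scaleR:
  fixes A :: "real^'n^'m" and B :: "real^'k^'n"
  shows "(c *\<^sub>R A) ** B = c *\<^sub>R (A ** B)" "A ** (c *\<^sub>R B) = c *\<^sub>R (A ** B)"
  by (simp_all add: Finite_Cartesian_Product.vec_eq_iff matrix_matrix_mult_def sum_distrib_left mult_ac)

context
  fixes lam :: real and m :: "real^3"
  assumes lam: "0 < lam"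
begin

lemma S_tilde_denominator_pos: "0 < lam\<^sup>2 + (norm m)\<^sup>2"
  using lam by (simp add: add_pos_nonneg)

lemma matrix_inv_shifted_S_tilde:
  "invertible (lam *\<^sub>R mat 1 + S_tilde m)"
  "matrix_inv (lam *\<^sub>R mat 1 + S_tilde m)
     = (1 / (lam\<^sup>2 + (norm m)\<^sup>2)) *\<^sub>R (lam *\<^sub>R mat 1 - S_tilde m)"
proof -
  let ?A = "lam *\<^sub>R mat 1 + S_tilde m"
  let ?B = "(1 / (lam\<^sup>2 + (norm m)\<^sup>2)) *\<^sub>R (lam *\<^sub>R mat 1 - S_tilde m)"
  have "?A ** ?B = mat 1" "?B ** ?A = mat 1"
    unfolding matrix_mult_scaleR shifted_S_tilde_products using lam S_tilde_denominator_pos by simp_all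
  then show "invertible ?A" "matrix_inv ?A = ?B"
    by (auto simp: invertible_def intro: matrix_inv_eqI)
qed

text \<open>The inverse is a multiple of the transposed block, so its Gram matrix is scalar as well.
  The two norms are reciprocal, which makes the condition number 1.\<close>

lemma spectral_norm_shifted_S_tilde:
  "spectral_norm (lam *\<^sub>R mat 1 + S_tilde m) = sqrt (lam\<^sup>2 + (norm m)\<^sup>2)"
  "spectral_norm (matrix_inv (lam *\<^sub>R mat 1 + S_tilde m)) = sqrt (1 / (lam\<^sup>2 + (norm m)\<^sup>2))"
proof -
  show "spectral_norm (lam *\<^sub>R mat 1 + S_tilde m) = sqrt (lam\<^sup>2 + (norm m)\<^sup>2)"
    using S_tilde_denominator_pos
    by (intro spectral_norm_scaled_isometry)
      (simp_all add: transpose_shifted_S_tilde shifted_S_tilde_products)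
  let ?B = "lam *\<^sub>R mat 1 - S_tilde m"
  have "transpose ?B = lam *\<^sub>R mat 1 + S_tilde m"
    by (simp add: Finite_Cartesian_Product.vec_eq_iff forall_4 transpose_def Finite_Cartesian_Product.mat_def)
  moreover have "transpose (c *\<^sub>R ?B) = c *\<^sub>R transpose ?B" for c
    by (simp add: Finite_Cartesian_Product.vec_eq_iff transpose_def)
  ultimately show "spectral_norm (matrix_inv (lam *\<^sub>R mat 1 + S_tilde m)) = sqrt (1 / (lam\<^sup>2 + (norm m)\<^sup>2))"
    using lam S_tilde_denominator_pos unfolding matrix_inv_shifted_S_tilde
    by (intro spectral_norm_scaled_isometry)
      (simp_all add: matrix_mult_scaleR shifted_S_tilde_products)
qed

lemma kappa\<^sub>2_shifted_S_tilde: "kappa\<^sub>2 (lam *\<^sub>R mat 1 + S_tilde m) = 1"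
  unfolding kappa\<^sub>2_def spectral_norm_shifted_S_tilde
  using lam S_tilde_denominator_pos by (simp flip: real_sqrt_mult)

lemma matrix_inv_shifted_S_tilde_scaled:
  "matrix_inv (lam *\<^sub>R mat 1 + S_tilde m) =
     (1 / (lam * ((m$1 / lam)\<^sup>2 + (m$2 / lam)\<^sup>2 + (m$3 / lam)\<^sup>2 + 1))) *\<^sub>R
     vector [vector [1, m$3 / lam, - (m$2 / lam), - (m$1 / lam)],
             vector [- (m$3 / lam), 1, m$1 / lam, - (m$2 / lam)],
             vector [m$2 / lam, - (m$1 / lam), 1, - (m$3 / lam)],
             vector [m$1 / lam, m$2 / lam, m$3 / lam, 1]]"
proof -
  define D where "D = lam\<^sup>2 + (norm m)\<^sup>2"
  \<comment> \<open>Dividing by \<open>D / lam\<close> instead of \<open>D\<close> supplies a factor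
    \<open>lam\<close>; it clears the denominators of the entries \<open>m$j / lam\<close> and turns
    the diagonal entries 1 into \<open>lam\<close>.\<close>
  have "lam * ((m$1 / lam)\<^sup>2 + (m$2 / lam)\<^sup>2 + (m$3 / lam)\<^sup>2 + 1) = D / lam"
    using lam by (simp add: D_def norm_mult_self_3 field_simps power2_eq_square)
  then show ?thesis
    unfolding matrix_inv_shifted_S_tilde D_def[symmetric]
    using lam
    by (simp add: Finite_Cartesian_Product.vec_eq_iff forall_4 Finite_Cartesian_Product.mat_def vector_4)
qed

end

section \<open>The discrete Fourier transform\<close>

lemma digit_Cons:
  "digit (n # ns) 0 q = q mod n" "digit (n # ns) (Suc l) q = digit ns l (q div n)"
  by (simp_all add: digit_def div_mult2_eq)

lemma digit_less: "0 < ns ! l \<Longrightarrow> digit ns l q < ns ! l"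
  by (simp add: digit_def)

text \<open>Uniqueness of mixed-radix representation: the first digit is the remainder modulo
  \<open>n\<close>, and the remaining digits are those of the quotient.\<close>

lemma digit_inj:
  assumes "i < Ng ns" "j < Ng ns" "\<And>l. l < length ns \<Longrightarrow> digit ns l i = digit ns l j"
  shows "i = j"
  using assms unfolding Ng_def
proof (induction ns arbitrary: i j)
  case (Cons n ns)
  \<comment> \<open>With \<open>n = 0\<close> the grid would be empty, contradicting the bound on
    \<open>i\<close>.\<close>
  have "n > 0" using Cons.prems(1) by (cases n) auto
  have "i div n = j div n"
  proof (rule Cons.IH)
    show "i div n < prod_list ns" "j div n < prod_list ns"
      using Cons.prems(1,2) \<open>n > 0\<close> by (simp_all add: less_mult_imp_div_less mult.commute)
    show "digit ns l (i div n) = digit ns l (j div n)" if "l < length ns" for l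
      using Cons.prems(3)[of "Suc l"] that by (simp add: digit_Cons)
  qed
  moreover have "i mod n = j mod n"
    using Cons.prems(3)[of 0] by (simp add: digit_Cons)
  ultimately show ?case by (metis div_mult_mod_eq)
qed simp

text \<open>Distributivity: as \<open>q\<close> runs through the grid, its digits run through all
  multi-indices once. The induction splits off the first direction.\<close>

lemma sum_prod_digits:
  fixes f :: "nat \<Rightarrow> nat \<Rightarrow> 'a::comm_semiring_1"
  shows "(\<Sum>q<Ng ns. \<Prod>l<length ns. f l (digit ns l q)) = (\<Prod>l<length ns. \<Sum>a<ns ! l. f l a)"
  unfolding Ng_def
proof (induction ns arbitrary: f)
  case (Cons n ns)
  let ?P = "prod_list ns" and ?h = "\<lambda>q. \<Prod>l<length ns. f (Suc l) (digit ns l q)"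
  have "(\<Sum>q<prod_list (n # ns). \<Prod>l<length (n # ns). f l (digit (n # ns) l q))
      = (\<Sum>q<?P * n. f 0 (q mod n) * ?h (q div n))"
    by (simp add: prod.lessThan_Suc_shift digit_Cons mult.commute del: prod.lessThan_Suc)
  \<comment> \<open>Group the numbers by their quotient \<open>p\<close>; within a group the
    remainder runs through all values below \<open>n\<close>.\<close>
  also have "\<dots> = (\<Sum>p<?P. \<Sum>q=p * n..<p * n + n. f 0 (q mod n) * ?h (q div n))"
    by (simp add: sum.nat_group)
  also have "\<dots> = (\<Sum>p<?P. \<Sum>a<n. f 0 a * ?h p)"
  proof (rule sum.cong[OF refl])
    fix p
    have "(\<Sum>q=p * n..<p * n + n. f 0 (q mod n) * ?h (q div n))
        = (\<Sum>a=0..<n. f 0 ((a + p * n) mod n) * ?h ((a + p * n) div n))"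
      using sum.shift_bounds_nat_ivl[of "\<lambda>q. f 0 (q mod n) * ?h (q div n)" 0 "p * n" n]
      by (simp add: add.commute)
    then show "(\<Sum>q=p * n..<p * n + n. f 0 (q mod n) * ?h (q div n)) = (\<Sum>a<n. f 0 a * ?h p)"
      by (simp add: atLeast0LessThan)
  qed
  also have "\<dots> = (\<Sum>a<n. f 0 a) * (\<Sum>p<?P. ?h p)"
    by (subst sum.swap) (simp add: sum_product)
  finally show ?case
    using Cons.IH[of "\<lambda>l. f (Suc l)"] by (simp add: prod.lessThan_Suc_shift del: prod.lessThan_Suc)
qed simp

section \<open>Fourier modes and their orthogonality\<close>

lemma cis_sum: "cis (sum f A) = (\<Prod>x\<in>A. cis (f x))"
  by (induction A rule: infinite_finite_induct) (simp_all flip: cis_mult)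

lemma cis_int_period:
  assumes "[a = b] (mod int n)" "0 < n"
  shows "cis (2 * pi * of_int a / real n) = cis (2 * pi * of_int b / real n)"
proof -
  obtain k where "a = b + int n * k"
    using cong_sym[OF assms(1)] by (auto simp: cong_iff_lin)
  then have "2 * pi * of_int a / real n = 2 * pi * of_int b / real n + 2 * pi * of_int k"
    using assms(2) by (simp add: field_simps)
  then show ?thesis by (simp flip: cis_mult)
qed

text \<open>A wave number differs from its digit by 0 or \<open>n\<close>, and node digits are
  integers, so passing to digits changes each phase by a multiple of a full turn. The resulting
  expression is symmetric in mode and node.\<close>

lemma cis_phase:
  assumes "\<forall>n\<in>set ns. 0 < n"
  shows "cis (phase ns q j)
    = (\<Prod>l<length ns. cis (2 * pi * of_int (int (digit ns l q) * int (digit ns l j)) / real (ns ! l)))"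
  unfolding phase_def cis_sum
proof (rule prod.cong[OF refl])
  fix l assume "l \<in> {..<length ns}"
  then have n: "0 < ns ! l" using assms by simp
  have "[wavenum ns q l * int (digit ns l j) = int (digit ns l q) * int (digit ns l j)] (mod int (ns ! l))"
    by (rule cong_mult) (auto simp: wavenum_def cong_def)
  from cis_int_period[OF this n]
  show "cis (2 * pi * of_int (wavenum ns q l) * real (digit ns l j) / real (ns ! l)) =
      cis (2 * pi * of_int (int (digit ns l q) * int (digit ns l j)) / real (ns ! l))"
    by (simp add: mult.assoc)
qed

lemma cis_phase_commute:
  "\<forall>n\<in>set ns. 0 < n \<Longrightarrow> cis (phase ns q j) = cis (phase ns j q)"
  by (simp add: cis_phase mult.commute)

lemma cis_phase_diff:
  assumes "\<forall>n\<in>set ns. 0 < n"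
  shows "cis (phase ns q i) * cis (- phase ns q j)
    = (\<Prod>l<length ns. cis (2 * pi * real (digit ns l q)
        * of_int (int (digit ns l i) - int (digit ns l j)) / real (ns ! l)))"
proof -
  have "cis (- phase ns q j) = inverse (cis (phase ns q j))" by simp
  then have "cis (phase ns q i) * cis (- phase ns q j)
      = (\<Prod>l<length ns. cis (2 * pi * of_int (int (digit ns l q) * int (digit ns l i)) / real (ns ! l))
         * inverse (cis (2 * pi * of_int (int (digit ns l q) * int (digit ns l j)) / real (ns ! l))))"
    unfolding cis_phase[OF assms] prod_inversef[symmetric] prod.distrib by (simp add: o_def)
  also have "\<dots> = (\<Prod>l<length ns. cis (2 * pi * real (digit ns l q)
        * of_int (int (digit ns l i) - int (digit ns l j)) / real (ns ! l)))"
    by (simp add: cis_mult cis_inverse algebra_simps diff_divide_distrib)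
  finally show ?thesis .
qed

text \<open>A geometric sum whose ratio \<open>z\<close> is an \<open>n\<close>-th root of unity.
  The bound on \<open>x\<close> excludes \<open>z = 1\<close> unless \<open>x = 0\<close>.\<close>

lemma sum_cis_multiples:
  assumes "\<bar>x\<bar> < int n"
  shows "(\<Sum>a<n. cis (2 * pi * real a * of_int x / real n)) = (if x = 0 then of_nat n else 0)"
proof (cases "x = 0")
  case False
  have n: "0 < n" using assms by simp
  define z where "z = cis (2 * pi * of_int x / real n)"
  have "cis (2 * pi * real a * of_int x / real n) = z ^ a" for a
    unfolding z_def Complex.DeMoivre by (rule arg_cong[of _ _ cis]) simp
  moreover have "z ^ n = 1"
    unfolding z_def Complex.DeMoivre using n by simp
  moreover have "z \<noteq> 1"
  proof
    assume "z = 1"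
    then have "cos (2 * pi * of_int x / real n) = 1"
      unfolding z_def by (metis cis.sel(1) one_complex.sel(1))
    then obtain k :: int where "2 * pi * of_int x / real n = of_int k * (2 * pi)"
      using cos_one_2pi_int by auto
    then have "real_of_int x = real_of_int (k * int n)"
      using n by (simp add: field_simps)
    then have "x = k * int n" by linarith
    \<comment> \<open>As \<open>x\<close> is nonzero, so is \<open>k\<close>, and the absolute value
      of \<open>x\<close> would be at least \<open>n\<close>.\<close>
    then have "1 * int n \<le> \<bar>k\<bar> * int n"
      using False by (intro mult_right_mono) auto
    then show False
      using assms \<open>x = k * int n\<close> by (simp add: abs_mult)
  qed
  ultimately show ?thesis
    using False by (simp add: sum_gp_strict)
qed simp

text \<open>The sum factorizes over the directions, and a direction in which the digits of
  \<open>i\<close> and \<open>j\<close> differ contributes a vanishing factor.\<close>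

lemma phase_orthogonal:
  assumes "\<forall>n\<in>set ns. 0 < n" "i < Ng ns" "j < Ng ns"
  shows "(\<Sum>q<Ng ns. cis (phase ns q i) * cis (- phase ns q j)) = (if i = j then of_nat (Ng ns) else 0)"
proof (cases "i = j")
  case True
  then show ?thesis by (simp add: cis_mult)
next
  case False
  then obtain l where l: "l < length ns" "digit ns l i \<noteq> digit ns l j"
    using digit_inj assms by blast
  let ?x = "\<lambda>l. int (digit ns l i) - int (digit ns l j)"
  have "digit ns l i < ns ! l" "digit ns l j < ns ! l"
    using l assms(1) by (simp_all add: digit_less)
  then have "(\<Sum>a<ns ! l. cis (2 * pi * real a * of_int (?x l) / real (ns ! l))) = 0"
    using l(2) by (subst sum_cis_multiples) auto
  then have "(\<Prod>l<length ns. \<Sum>a<ns ! l. cis (2 * pi * real a * of_int (?x l) / real (ns ! l))) = 0"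
    using l(1) by (intro prod_zero) auto
  then show ?thesis
    using False unfolding cis_phase_diff[OF assms(1)]
      sum_prod_digits[of "\<lambda>l a. cis (2 * pi * real a * of_int (?x l) / real (ns ! l))"]
    by simp
qed

section \<open>Inversion of the transform and of Fourier multipliers\<close>

lemma Ng_pos: "\<forall>n\<in>set ns. 0 < n \<Longrightarrow> 0 < Ng ns"
  unfolding Ng_def by (induction ns) auto

lemma idft_dft:
  assumes ns: "\<forall>n\<in>set ns. 0 < n" and j: "j < Ng ns"
  shows "idft ns (dft ns u) j = u j"
proof -
  have "(\<Sum>q<Ng ns. dft ns u q * cis (phase ns q j))
      = (\<Sum>i<Ng ns. u i * (\<Sum>q<Ng ns. cis (phase ns q j) * cis (- phase ns q i)))"
    unfolding dft_def sum_distrib_right sum_distrib_left by (subst sum.swap) (simp add: mult_ac)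
  also have "\<dots> = (\<Sum>i<Ng ns. if j = i then u i * of_nat (Ng ns) else 0)"
    using j by (intro sum.cong) (simp_all add: phase_orthogonal[OF ns])
  also have "\<dots> = u j * of_nat (Ng ns)"
    using j by simp
  finally show ?thesis
    using Ng_pos[OF ns] by (simp add: idft_def)
qed

lemma dft_idft:
  assumes ns: "\<forall>n\<in>set ns. 0 < n" and p: "p < Ng ns"
  shows "dft ns (idft ns u) p = u p"
proof -
  \<comment> \<open>Exchanging mode and node turns the sum over nodes into the sum over modes
    covered by \<open>phase_orthogonal\<close>.\<close>
  have neg: "cis (- phase ns q j) = cis (- phase ns j q)" for q j
    using cis_phase_commute[OF ns, of q j] by (metis cis_inverse)
  have "dft ns (idft ns u) p
      = (\<Sum>q<Ng ns. u q * (\<Sum>j<Ng ns. cis (phase ns j q) * cis (- phase ns j p))) / of_nat (Ng ns)"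
    unfolding dft_def idft_def sum_distrib_right sum_distrib_left sum_divide_distrib
    by (subst sum.swap) (simp add: mult_ac cis_phase_commute[OF ns] neg[of p])
  also have "(\<Sum>q<Ng ns. u q * (\<Sum>j<Ng ns. cis (phase ns j q) * cis (- phase ns j p)))
      = (\<Sum>q<Ng ns. if q = p then u q * of_nat (Ng ns) else 0)"
    using p by (intro sum.cong) (simp_all add: phase_orthogonal[OF ns])
  also have "\<dots> = u p * of_nat (Ng ns)"
    using p by simp
  finally show ?thesis
    using Ng_pos[OF ns] by simp
qed

lemma idft_cong: "(\<And>q. q < Ng ns \<Longrightarrow> u q = v q) \<Longrightarrow> idft ns u = idft ns v"
  by (simp add: idft_def fun_eq_iff)

lemma dft_cong: "(\<And>j. j < Ng ns \<Longrightarrow> u j = v j) \<Longrightarrow> dft ns u = dft ns v"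
  by (simp add: dft_def fun_eq_iff)

text \<open>Transforming the equation decouples the modes, and at each mode the nonzero symbol
  \<open>g\<close> can be divided out. Applied to an unknown \<open>u\<close>, this shows that
  \<open>v\<close> determines it.\<close>

lemma idft_eq_multiplier_iff:
  assumes ns: "\<forall>n\<in>set ns. 0 < n" and nz: "\<And>q. g q \<noteq> 0"
    and eq: "\<And>i. i < Ng ns \<Longrightarrow> v i = idft ns (\<lambda>q. g q * dft ns u q) i" and i: "i < Ng ns"
  shows "u i = idft ns (\<lambda>q. dft ns v q / g q) i"
proof -
  have "dft ns v = dft ns (idft ns (\<lambda>q. g q * dft ns u q))"
    by (rule dft_cong) (rule eq)
  then have "dft ns v q = g q * dft ns u q" if "q < Ng ns" for q
    using dft_idft[OF ns that] by simp
  then have "idft ns (\<lambda>q. dft ns v q / g q) = idft ns (dft ns u)"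
    using nz by (intro idft_cong) simp
  then show ?thesis using idft_dft[OF ns i] by simp
qed

section \<open>The discrete Laplacian: real kernel and action\<close>

lemma dft_indicator:
  "j < Ng ns \<Longrightarrow> dft ns (\<lambda>i. if i = j then 1 else 0) q = cis (- phase ns q j)"
  by (simp add: dft_def if_distrib[of "\<lambda>x. x * _"] cong: if_cong)

text \<open>The terms at \<open>a\<close> and \<open>(n - a) mod n\<close> are complex conjugates.\<close>

lemma sum_even_cis_real:
  fixes h :: "nat \<Rightarrow> real"
  assumes even: "\<And>a. a < n \<Longrightarrow> h ((n - a) mod n) = h a"
  shows "(\<Sum>a<n. of_real (h a) * cis (2 * pi * real a * of_int x / real n)) \<in> \<real>"
proof -
  let ?f = "\<lambda>a. of_real (h a) * cis (2 * pi * real a * of_int x / real n)"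
  have "cnj (?f ((n - a) mod n)) = ?f a" if "a < n" for a
  proof (cases "a = 0")
    case False
    have n: "0 < n" using that by simp
    have "cis (2 * pi * of_int (- (int (n - a) * x)) / real n) = cis (2 * pi * of_int (int a * x) / real n)"
    proof (rule cis_int_period[OF _ n])
      have "- (int (n - a) * x) - int a * x = int n * (- x)"
        using that by (simp add: of_nat_diff algebra_simps)
      then show "[- (int (n - a) * x) = int a * x] (mod int n)"
        by (metis cong_iff_dvd_diff dvd_triv_left)
    qed
    then show ?thesis
      using False that even[OF that] by (simp add: cis_cnj mult.assoc)
  qed (use that even[OF that] in simp)
  then have f_reflect: "?f ((n - a) mod n) = cnj (?f a)" if "a < n" for a
    using that by (metis complex_cnj_cnj)
  \<comment> \<open>The outer \<open>mod n\<close> brings the reflection of 0 back to 0. Being an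
    involution, the reflection permutes the summands, so the sum equals its own conjugate.\<close>
  have involution: "(n - (n - a) mod n) mod n = a \<and> (n - a) mod n < n" if "a < n" for a
    using that by (cases "a = 0") auto
  have "(\<Sum>a<n. cnj (?f a)) = (\<Sum>a<n. ?f a)"
    by (rule sum.reindex_bij_witness[of _ "\<lambda>a. (n - a) mod n" "\<lambda>a. (n - a) mod n"])
      (simp_all only: lessThan_iff involution f_reflect)
  then have "cnj (\<Sum>a<n. ?f a) = (\<Sum>a<n. ?f a)"
    by (simp only: cnj_sum)
  then show ?thesis
    by (simp only: Reals_cnj_iff)
qed

text \<open>Isolates the part of the symbol that depends on a single digit, so that sums over the
  grid containing it still factorize.\<close>

definition wave_sq1 :: "nat \<Rightarrow> real \<Rightarrow> nat \<Rightarrow> real" where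
  "wave_sq1 n L a = (2 * pi * of_int (if 2 * a < n then int a else int a - int n) / L)\<^sup>2"

text \<open>Reflection fixes \<open>a = 0\<close> and the unpaired mode \<open>n = 2 * a\<close>;
  otherwise it reverses the sign of the wave number, which squaring removes.\<close>

lemma wave_sq1_reflect:
  assumes "a < n"
  shows "wave_sq1 n L ((n - a) mod n) = wave_sq1 n L a"
proof -
  consider "a = 0" | "n = 2 * a" "a \<noteq> 0" | "a \<noteq> 0" "n \<noteq> 2 * a" by blast
  then show ?thesis
    by cases (use assms in \<open>auto simp: wave_sq1_def of_nat_diff power_divide power_mult_distrib power2_commute\<close>)
qed

lemma wave_norm_sq_digits:
  "wave_norm_sq ns Ls q = (\<Sum>l<length ns. wave_sq1 (ns ! l) (Ls ! l) (digit ns l q))"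
  by (simp add: wave_norm_sq_def wave_vector_def wavenum_def wave_sq1_def)

text \<open>For each summand \<open>l\<close> of the symbol the grid sum is a product of
  one-dimensional sums. Their weights, \<open>wave_sq1\<close> in direction \<open>l\<close> and 1
  elsewhere, are invariant under reflection, so every factor is real.\<close>

lemma laplacian_kernel_real:
  assumes "\<forall>n\<in>set ns. 0 < n"
  shows "(\<Sum>q<Ng ns. of_real (wave_norm_sq ns Ls q) * (cis (phase ns q i) * cis (- phase ns q j))) \<in> \<real>"
proof -
  let ?c = "\<lambda>l a. cis (2 * pi * real a * of_int (int (digit ns l i) - int (digit ns l j)) / real (ns ! l))"
  let ?h = "\<lambda>l k a. if k = l then wave_sq1 (ns ! l) (Ls ! l) a else 1"
  \<comment> \<open>The weight of direction \<open>l\<close> is absorbed into the product over all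
    directions, in the shape that \<open>sum_prod_digits\<close> expects.\<close>
  have *: "of_real (wave_sq1 (ns ! l) (Ls ! l) (digit ns l q)) * (\<Prod>k<length ns. ?c k (digit ns k q))
      = (\<Prod>k<length ns. of_real (?h l k (digit ns k q)) * ?c k (digit ns k q))"
    if "l < length ns" for l q
    unfolding prod.distrib using that
    by (simp add: of_real_def[symmetric] if_distrib[of of_real] cong: if_cong)
  have "(\<Sum>q<Ng ns. of_real (wave_norm_sq ns Ls q) * (cis (phase ns q i) * cis (- phase ns q j)))
      = (\<Sum>l<length ns. \<Sum>q<Ng ns. \<Prod>k<length ns. of_real (?h l k (digit ns k q)) * ?c k (digit ns k q))"
    unfolding cis_phase_diff[OF assms] wave_norm_sq_digits of_real_sum sum_distrib_right
    by (subst sum.swap, intro sum.cong[OF refl] *) simp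
  also have "\<dots> = (\<Sum>l<length ns. \<Prod>k<length ns. \<Sum>a<ns ! k. of_real (?h l k a) * ?c k a)"
    using sum_prod_digits[of "\<lambda>k a. of_real (?h l k a) * ?c k a" ns for l] by simp
  also have "\<dots> \<in> \<real>"
    by (intro sum_in_Reals prod_in_Reals sum_even_cis_real) (auto simp: wave_sq1_reflect)
  finally show ?thesis .
qed

text \<open>Here realness of the kernel shows that \<open>Re\<close> in the definition of
  \<open>neg_laplacian\<close> discards nothing, so the matrix acts as the Fourier multiplier, even
  on complex grid functions.\<close>

lemma neg_laplacian_apply:
  assumes ns: "\<forall>n\<in>set ns. 0 < n" and i: "i < Ng ns"
  shows "(\<Sum>j<Ng ns. of_real (neg_laplacian ns Ls $$ (i, j)) * u j)
    = idft ns (\<lambda>q. of_real (wave_norm_sq ns Ls q) * dft ns u q) i"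
proof -
  have K: "of_real (neg_laplacian ns Ls $$ (i, j))
      = (\<Sum>q<Ng ns. of_real (wave_norm_sq ns Ls q) * (cis (phase ns q i) * cis (- phase ns q j))) / of_nat (Ng ns)"
    (is "_ = ?S / _") if "j < Ng ns" for j
  proof -
    let ?k = "idft ns (\<lambda>q. of_real (wave_norm_sq ns Ls q) * dft ns (\<lambda>i. if i = j then 1 else 0) q) i"
    have "?k = ?S / of_nat (Ng ns)"
      by (simp add: idft_def dft_indicator that mult_ac)
    moreover have "?S / of_nat (Ng ns) \<in> \<real>"
      using laplacian_kernel_real[OF ns] by (intro Reals_divide) simp_all
    moreover have "neg_laplacian ns Ls $$ (i, j) = Re ?k"
      using i that by (simp add: neg_laplacian_def)
    ultimately show ?thesis
      by (simp only: of_real_Re)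
  qed
  have "(\<Sum>j<Ng ns. of_real (neg_laplacian ns Ls $$ (i, j)) * u j)
     = (\<Sum>j<Ng ns. \<Sum>q<Ng ns. of_real (wave_norm_sq ns Ls q) * (u j * cis (- phase ns q j)) * cis (phase ns q i) / of_nat (Ng ns))"
    by (simp add: K sum_distrib_right sum_distrib_left sum_divide_distrib mult_ac)
  also have "\<dots> = idft ns (\<lambda>q. of_real (wave_norm_sq ns Ls q) * dft ns u q) i"
    unfolding idft_def dft_def
    by (subst sum.swap) (simp add: sum_distrib_right sum_distrib_left sum_divide_distrib mult_ac)
  finally show ?thesis .
qed

section \<open>The factors of the preconditioner\<close>

text \<open>\<open>mat_inverse\<close> is a Gauss-Jordan procedure: it fails only on non-units of
  the matrix ring, and on success its result must agree with \<open>B\<close> by uniqueness.\<close>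

lemma mat_inverse_eq_SomeI:
  fixes A :: "'a::field Matrix.mat"
  assumes A: "A \<in> carrier_mat n n" and B: "B \<in> carrier_mat n n"
    and AB: "A * B = 1\<^sub>m n" and BA: "B * A = 1\<^sub>m n"
  shows "mat_inverse A = Some B"
proof (cases "mat_inverse A")
  case None
  have "A \<in> Units (ring_mat TYPE('a) n ())"
    using A B AB BA by (auto simp: Units_def ring_mat_def)
  then show ?thesis using mat_inverse(1)[OF A None, of "()"] by blast
next
  case (Some C)
  then have C: "A * C = 1\<^sub>m n" "C \<in> carrier_mat n n"
    using mat_inverse(2)[OF A] by auto
  have "C = B * A * C"
    using C BA by simp
  also have "\<dots> = B"
    using assoc_mult_mat[OF B A C(2)] C(1) B by simp
  finally show ?thesis using Some by simp
qed

lemma mat_inverse_SomeD: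
  assumes "A \<in> carrier_mat n n" "mat_inverse A = Some B"
  shows "B \<in> carrier_mat n n" "A * B = 1\<^sub>m n" "B * A = 1\<^sub>m n"
    "\<And>b. b \<in> carrier_vec n \<Longrightarrow> A *\<^sub>v (B *\<^sub>v b) = b"
proof -
  show *: "B \<in> carrier_mat n n" "A * B = 1\<^sub>m n" "B * A = 1\<^sub>m n"
    using mat_inverse(2)[OF assms] by auto
  show "A *\<^sub>v (B *\<^sub>v b) = b" if "b \<in> carrier_vec n" for b
    using assoc_mult_mat_vec[OF assms(1) *(1) that] *(2) that by simp
qed

text \<open>A trivial kernel forces a nonzero determinant, hence a unit. This gives existence of the
  inverses without exhibiting the global matrices.\<close>

lemma mat_inverse_ex_if_inj:
  fixes A :: "'a::field Matrix.mat"
  assumes A: "A \<in> carrier_mat n n"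
    and inj: "\<And>x. x \<in> carrier_vec n \<Longrightarrow> A *\<^sub>v x = 0\<^sub>v n \<Longrightarrow> x = 0\<^sub>v n"
  shows "\<exists>B. mat_inverse A = Some B"
proof (cases "mat_inverse A")
  case None
  then have "Determinant.det A = 0"
    using mat_inverse(1)[OF A, of "()"] det_non_zero_imp_unit[OF A, of "()"] by blast
  then show ?thesis
    using inj det_0_iff_vec_prod_zero_field[OF A] by auto
qed simp

lemma mat_inverse_mult:
  fixes A B :: "'a::field Matrix.mat"
  assumes A: "A \<in> carrier_mat n n" "mat_inverse A = Some A'"
    and B: "B \<in> carrier_mat n n" "mat_inverse B = Some B'"
  shows "mat_inverse (A * B) = Some (B' * A')"
proof (rule mat_inverse_eq_SomeI)
  note A' = mat_inverse_SomeD(1-3)[OF A] and B' = mat_inverse_SomeD(1-3)[OF B]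
  show AB: "A * B \<in> carrier_mat n n" "B' * A' \<in> carrier_mat n n"
    using A B A' B' by auto
  have "A * B * (B' * A') = A * (B * B' * A')"
    unfolding assoc_mult_mat[OF A(1) B(1) AB(2)] assoc_mult_mat[OF B(1) B'(1) A'(1)] ..
  then show "A * B * (B' * A') = 1\<^sub>m n"
    using A A' B' by simp
  have "B' * A' * (A * B) = B' * (A' * A * B)"
    unfolding assoc_mult_mat[OF B'(1) A'(1) AB(1)] assoc_mult_mat[OF A'(1) A(1) B(1)] ..
  then show "B' * A' * (A * B) = 1\<^sub>m n"
    using B A' B' by simp
qed

section \<open>Splitting global vectors into nodes and components\<close>

lemma entry_less: "c < 4 \<Longrightarrow> i < N \<Longrightarrow> entry N c i < 4 * N"
  by (auto simp: entry_def)

lemma entry_simps: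
  "c < 3 \<Longrightarrow> entry N c i div 3 = i" "c < 3 \<Longrightarrow> entry N c i mod 3 = c"
  "c < 3 \<Longrightarrow> i < N \<Longrightarrow> entry N c i < 3 * N"
  "c < 3 \<Longrightarrow> i < N \<Longrightarrow> entry N c i < 4 * N"
  "entry N 3 i = 3 * N + i"
  by (auto simp: entry_def)

lemma entry_cases:
  assumes "r < 4 * N"
  obtains c i where "c < 4" "i < N" "r = entry N c i"
proof (cases "r < 3 * N")
  case True
  then show ?thesis
    using that[of "r mod 3" "r div 3"] by (simp add: entry_def less_mult_imp_div_less mult.commute)
next
  case False
  then show ?thesis
    using that[of 3 "r - 3 * N"] assms by (simp add: entry_def)
qed

lemma less_4_cases: "c < 4 \<Longrightarrow> c = 0 \<or> c = 1 \<or> c = 2 \<or> c = 3" for c :: nat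
  by auto

lemma sum_lessThan_4: "(\<Sum>c<4. f c) = f 0 + f 1 + f 2 + f (3::nat)"
  by (simp add: eval_nat_numeral)

lemma sum_entry:
  fixes f :: "nat \<Rightarrow> 'a::comm_monoid_add"
  shows "(\<Sum>r<4 * N. f r) = (\<Sum>j<N. \<Sum>c<4. f (entry N c j))"
proof -
  have "(\<Sum>r<4 * N. f r) = (\<Sum>r<3 * N. f r) + (\<Sum>j<N. f (3 * N + j))"
    using sum.atLeastLessThan_concat[of 0 "3 * N" "4 * N" f]
      sum.shift_bounds_nat_ivl[of f 0 "3 * N" N]
    by (simp add: atLeast0LessThan add.commute)
  \<comment> \<open>The velocity entries are interleaved node by node, whereas the multipliers form
    one block at the end.\<close>
  also have "(\<Sum>r<3 * N. f r) = (\<Sum>j<N. f (3 * j) + f (3 * j + 1) + f (3 * j + 2))"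
    by (induction N) (simp_all add: add_ac eval_nat_numeral)
  finally show ?thesis
    by (simp add: sum.distrib sum_lessThan_4 entry_def)
qed

lemma mult_mat_vec_entry:
  assumes "A \<in> carrier_mat (4 * N) (4 * N)" "x \<in> carrier_vec (4 * N)" "c < 4" "i < N"
  shows "(A *\<^sub>v x) $\<^sub>v entry N c i
    = (\<Sum>j<N. \<Sum>c'<4. A $$ (entry N c i, entry N c' j) * x $\<^sub>v entry N c' j)"
proof -
  have "(A *\<^sub>v x) $\<^sub>v entry N c i = (\<Sum>r<4 * N. A $$ (entry N c i, r) * x $\<^sub>v r)"
    using assms entry_less[OF assms(3,4)] by (simp add: scalar_prod_def atLeast0LessThan)
  then show ?thesis by (simp add: sum_entry)
qed

lemma vec_eq_entryI:
  assumes "x \<in> carrier_vec (4 * N)" "y \<in> carrier_vec (4 * N)"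
    and "\<And>c i. c < 4 \<Longrightarrow> i < N \<Longrightarrow> x $\<^sub>v entry N c i = y $\<^sub>v entry N c i"
  shows "x = y"
  by (rule eq_vecI) (use assms in \<open>auto elim!: entry_cases\<close>)

lemma shifted_carrier: "A \<in> carrier_mat n n \<Longrightarrow> shifted lam A \<in> carrier_mat n n"
  by (auto simp: shifted_def)

lemma shifted_mult_entry:
  assumes A: "A \<in> carrier_mat (4 * N) (4 * N)" and x: "x \<in> carrier_vec (4 * N)"
    and c: "c < 4" and i: "i < N"
  shows "(shifted lam A *\<^sub>v x) $\<^sub>v entry N c i
    = (A *\<^sub>v x) $\<^sub>v entry N c i + lam * x $\<^sub>v entry N c i"
proof -
  have "shifted lam A *\<^sub>v x = A *\<^sub>v x + lam \<cdot>\<^sub>v x"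
  proof -
    have "(lam \<cdot>\<^sub>m 1\<^sub>m (4 * N)) *\<^sub>v x = lam \<cdot>\<^sub>v x"
      by (rule eq_vecI) (use x in simp_all)
    then show ?thesis
      unfolding shifted_def using A x add_mult_distrib_mat_vec[of A "4 * N" "4 * N" "lam \<cdot>\<^sub>m 1\<^sub>m (4 * N)" x]
      by simp
  qed
  then show ?thesis
    using entry_less[OF c i] A x by simp
qed

subsection \<open>The node-local factor\<close>

lemma calS_carrier: "calS N ms \<in> carrier_mat (4 * N) (4 * N)"
  by (auto simp: calS_def S_mat_def B_mat_def)

text \<open>The regrouping by nodes: in the numbering by \<open>entry\<close> the matrix is block
  diagonal with blocks \<open>S_tilde (ms i)\<close>. \<open>Suc\<close> appears because components
  count from 0 and the index type \<open>4\<close> counts from 1.\<close>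

lemma calS_entry:
  assumes "c < 4" "i < N" "c' < 4" "j < N"
  shows "calS N ms $$ (entry N c i, entry N c' j)
    = (if i = j then S_tilde (ms i) $ of_nat (Suc c) $ of_nat (Suc c') else 0)"
  using less_4_cases[OF assms(1)] less_4_cases[OF assms(3)] assms(2,4)
  by (elim disjE)
    (simp_all add: calS_def S_mat_def B_mat_def entry_simps comp3_def cross3_def axis_def vector_3)

lemma node_vec_shifted_calS:
  assumes x: "x \<in> carrier_vec (4 * N)" and i: "i < N"
  shows "node_vec N (shifted lam (calS N ms) *\<^sub>v x) i
    = (lam *\<^sub>R mat 1 + S_tilde (ms i)) *v node_vec N x i"
proof -
  have "(shifted lam (calS N ms) *\<^sub>v x) $\<^sub>v entry N c i
      = (\<Sum>c'<4. S_tilde (ms i) $ of_nat (Suc c) $ of_nat (Suc c') * x $\<^sub>v entry N c' i)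
        + lam * x $\<^sub>v entry N c i" if "c < 4" for c
  proof -
    have "(calS N ms *\<^sub>v x) $\<^sub>v entry N c i = (\<Sum>j<N. if i = j then
        \<Sum>c'<4. S_tilde (ms i) $ of_nat (Suc c) $ of_nat (Suc c') * x $\<^sub>v entry N c' i else 0)"
      unfolding mult_mat_vec_entry[OF calS_carrier x that i]
      by (intro sum.cong) (auto simp: calS_entry that i)
    then show ?thesis
      using i by (simp add: shifted_mult_entry[OF calS_carrier x that i])
  qed
  note this[of 0] this[of 1] this[of 2] this[of 3]
  then show ?thesis
    by (simp add: Finite_Cartesian_Product.vec_eq_iff forall_4 sum_4 matrix_vector_mult_def
        Finite_Cartesian_Product.mat_def node_vec_def vector_4 sum_lessThan_4)
qed

lemma node_vec_eq_iff:
  "node_vec N x i = node_vec N' y j \<longleftrightarrow> (\<forall>c<4. x $\<^sub>v entry N c i = y $\<^sub>v entry N' c j)"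
  by (auto simp: node_vec_def Finite_Cartesian_Product.vec_eq_iff forall_4 vector_4 dest!: less_4_cases)

lemma shifted_S_tilde_solve:
  assumes "0 < lam" "(lam *\<^sub>R mat 1 + S_tilde m) *v x = b"
  shows "x = ((1 / (lam\<^sup>2 + (norm m)\<^sup>2)) *\<^sub>R (lam *\<^sub>R mat 1 - S_tilde m)) *v b"
  unfolding assms(2)[symmetric] matrix_vector_mul_assoc matrix_mult_scaleR shifted_S_tilde_products
  using assms(1) S_tilde_denominator_pos[OF assms(1), of m] by simp

text \<open>The local solution formula recovers any vector from its image. For image 0 it gives
  injectivity, hence existence of \<open>Sinv\<close>; for image \<open>b\<close> it identifies
  \<open>Sinv\<close> node by node.\<close>

lemma mat_inverse_shifted_calS:
  assumes lam: "0 < lam"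
  obtains Sinv where "mat_inverse (shifted lam (calS N ms)) = Some Sinv"
    and "\<And>b i. b \<in> carrier_vec (4 * N) \<Longrightarrow> i < N \<Longrightarrow> node_vec N (Sinv *\<^sub>v b) i
      = ((1 / (lam\<^sup>2 + (norm (ms i))\<^sup>2)) *\<^sub>R (lam *\<^sub>R mat 1 - S_tilde (ms i))) *v node_vec N b i"
proof -
  let ?A = "shifted lam (calS N ms)"
  note A = shifted_carrier[OF calS_carrier]
  have "x = 0\<^sub>v (4 * N)" if x: "x \<in> carrier_vec (4 * N)" and 0: "?A *\<^sub>v x = 0\<^sub>v (4 * N)" for x
  proof (rule vec_eq_entryI[OF x])
    fix c i :: nat assume c: "c < 4" and i: "i < N"
    have "node_vec N (0\<^sub>v (4 * N)) i = 0"
      using i entry_less[of _ i N]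
      by (simp add: node_vec_def Finite_Cartesian_Product.vec_eq_iff forall_4 vector_4)
    then have "node_vec N x i = node_vec N (0\<^sub>v (4 * N)) i"
      using shifted_S_tilde_solve[OF lam node_vec_shifted_calS[OF x i, symmetric], of ms] 0
      by (simp add: matrix_vector_mult_0_right)
    then show "x $\<^sub>v entry N c i = 0\<^sub>v (4 * N) $\<^sub>v entry N c i"
      using c node_vec_eq_iff by blast
  qed simp
  then obtain Sinv where Sinv: "mat_inverse ?A = Some Sinv"
    using mat_inverse_ex_if_inj[OF A] by blast
  note Sinv_mult = mat_inverse_SomeD(1,4)[OF A Sinv]
  show ?thesis
  proof (rule that[OF Sinv])
    fix b :: "real Matrix.vec" and i assume b: "b \<in> carrier_vec (4 * N)" and i: "i < N"
    have "Sinv *\<^sub>v b \<in> carrier_vec (4 * N)"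
      using Sinv_mult(1) b by auto
    from shifted_S_tilde_solve[OF lam node_vec_shifted_calS[OF this i, symmetric], of ms]
    show "node_vec N (Sinv *\<^sub>v b) i
      = ((1 / (lam\<^sup>2 + (norm (ms i))\<^sup>2)) *\<^sub>R (lam *\<^sub>R mat 1 - S_tilde (ms i))) *v node_vec N b i"
      using Sinv_mult(2)[OF b] by simp
  qed
qed

subsection \<open>The Fourier-diagonal factor\<close>

lemma calH_carrier: "calH ns Ls \<alpha> \<theta> k Cexc \<in> carrier_mat (4 * Ng ns) (4 * Ng ns)"
  by (auto simp: calH_def H_mat_def Let_def)

lemma calH_entry:
  assumes "c < 4" "i < Ng ns" "c' < 4" "j < Ng ns"
  shows "calH ns Ls \<alpha> \<theta> k Cexc $$ (entry (Ng ns) c i, entry (Ng ns) c' j)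
    = (if c = c' \<and> c < 3
       then (if i = j then \<alpha> else 0) + \<theta> * k * Cexc * neg_laplacian ns Ls $$ (i, j) else 0)"
  using less_4_cases[OF assms(1)] less_4_cases[OF assms(3)] assms(2,4)
  by (elim disjE) (simp_all add: calH_def H_mat_def Let_def entry_simps neg_laplacian_def)

lemma shifted_calH_mult:
  assumes ns: "\<forall>n\<in>set ns. 0 < n" and x: "x \<in> carrier_vec (4 * Ng ns)" and i: "i < Ng ns"
  shows "(shifted lam (calH ns Ls \<alpha> \<theta> k Cexc) *\<^sub>v x) $\<^sub>v entry (Ng ns) 3 i
      = lam * x $\<^sub>v entry (Ng ns) 3 i"
    and "c < 3 \<Longrightarrow> of_real ((shifted lam (calH ns Ls \<alpha> \<theta> k Cexc) *\<^sub>v x) $\<^sub>v entry (Ng ns) c i)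
      = idft ns (\<lambda>q. of_real (\<alpha> + \<theta> * k * Cexc * wave_norm_sq ns Ls q + lam)
          * dft ns (\<lambda>j. of_real (x $\<^sub>v entry (Ng ns) c j)) q) i"
proof -
  let ?N = "Ng ns" and ?L = "neg_laplacian ns Ls"
  show "(shifted lam (calH ns Ls \<alpha> \<theta> k Cexc) *\<^sub>v x) $\<^sub>v entry ?N 3 i = lam * x $\<^sub>v entry ?N 3 i"
    using i by (simp add: shifted_mult_entry[OF calH_carrier x] mult_mat_vec_entry[OF calH_carrier x] calH_entry)
  assume c: "c < 3"
  let ?u = "\<lambda>j. complex_of_real (x $\<^sub>v entry ?N c j)"
  have "(calH ns Ls \<alpha> \<theta> k Cexc *\<^sub>v x) $\<^sub>v entry ?N c i
      = (\<Sum>j<?N. \<Sum>c'<4. if c' = c then ((if i = j then \<alpha> else 0) + \<theta> * k * Cexc * ?L $$ (i, j)) * x $\<^sub>v entry ?N c' j else 0)"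
    using c i unfolding mult_mat_vec_entry[OF calH_carrier x less_trans[OF c, of 4, simplified] i]
    by (intro sum.cong refl) (auto simp: calH_entry)
  also have "\<dots> = (\<Sum>j<?N. ((if i = j then \<alpha> else 0) + \<theta> * k * Cexc * ?L $$ (i, j)) * x $\<^sub>v entry ?N c j)"
    using c by simp
  also have "\<dots> = (\<Sum>j<?N. if i = j then \<alpha> * x $\<^sub>v entry ?N c i else 0)
      + \<theta> * k * Cexc * (\<Sum>j<?N. ?L $$ (i, j) * x $\<^sub>v entry ?N c j)"
    unfolding sum_distrib_left sum.distrib[symmetric] by (intro sum.cong) (auto simp: algebra_simps)
  also have "\<dots> = \<alpha> * x $\<^sub>v entry ?N c i + \<theta> * k * Cexc * (\<Sum>j<?N. ?L $$ (i, j) * x $\<^sub>v entry ?N c j)"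
    using i by simp
  finally have "of_real ((shifted lam (calH ns Ls \<alpha> \<theta> k Cexc) *\<^sub>v x) $\<^sub>v entry ?N c i)
      = (of_real \<alpha> + of_real lam) * ?u i + of_real (\<theta> * k * Cexc) * (\<Sum>j<?N. of_real (?L $$ (i, j)) * ?u j)"
    using c i by (simp add: shifted_mult_entry[OF calH_carrier x] algebra_simps)
  \<comment> \<open>By Fourier inversion the identity is the multiplier with symbol 1, so the scalar
    terms and the Laplacian merge into one symbol.\<close>
  also have "\<dots> = (of_real \<alpha> + of_real lam) * idft ns (dft ns ?u) i
      + of_real (\<theta> * k * Cexc) * idft ns (\<lambda>q. of_real (wave_norm_sq ns Ls q) * dft ns ?u q) i"
    by (simp only: idft_dft[OF ns i] neg_laplacian_apply[OF ns i])
  also have "\<dots> = idft ns (\<lambda>q. of_real (\<alpha> + \<theta> * k * Cexc * wave_norm_sq ns Ls q + lam) * dft ns ?u q) i"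
    by (simp add: idft_def sum_distrib_left sum_divide_distrib algebra_simps add_divide_distrib sum.distrib)
  finally show "of_real ((shifted lam (calH ns Ls \<alpha> \<theta> k Cexc) *\<^sub>v x) $\<^sub>v entry (Ng ns) c i)
      = idft ns (\<lambda>q. of_real (\<alpha> + \<theta> * k * Cexc * wave_norm_sq ns Ls q + lam) * dft ns ?u q) i" .
qed

lemma wave_norm_sq_nonneg: "0 \<le> wave_norm_sq ns Ls q"
  unfolding wave_norm_sq_def by (intro sum_nonneg) simp

lemma mat_inverse_shifted_calH:
  assumes ns: "\<forall>n\<in>set ns. 0 < n" and pos: "0 < \<alpha>" "0 \<le> \<theta> * k * Cexc" "0 < lam"
  obtains Hinv where "mat_inverse (shifted lam (calH ns Ls \<alpha> \<theta> k Cexc)) = Some Hinv"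
    and "\<And>b i c. b \<in> carrier_vec (4 * Ng ns) \<Longrightarrow> i < Ng ns \<Longrightarrow> c < 3 \<Longrightarrow>
      of_real ((Hinv *\<^sub>v b) $\<^sub>v entry (Ng ns) c i)
        = idft ns (\<lambda>q. dft ns (\<lambda>j. of_real (b $\<^sub>v entry (Ng ns) c j)) q
            / of_real (\<alpha> + \<theta> * k * Cexc * wave_norm_sq ns Ls q + lam)) i"
    and "\<And>b i. b \<in> carrier_vec (4 * Ng ns) \<Longrightarrow> i < Ng ns \<Longrightarrow>
      (Hinv *\<^sub>v b) $\<^sub>v entry (Ng ns) 3 i = b $\<^sub>v entry (Ng ns) 3 i / lam"
proof -
  let ?N = "Ng ns" and ?A = "shifted lam (calH ns Ls \<alpha> \<theta> k Cexc)"
  let ?g = "\<lambda>q. complex_of_real (\<alpha> + \<theta> * k * Cexc * wave_norm_sq ns Ls q + lam)"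
  note A = shifted_carrier[OF calH_carrier]
  have "0 < \<alpha> + \<theta> * k * Cexc * wave_norm_sq ns Ls q + lam" for q
    using pos mult_nonneg_nonneg[OF pos(2) wave_norm_sq_nonneg[of ns Ls q]] by linarith
  then have g: "?g q \<noteq> 0" for q
    by (metis of_real_eq_0_iff less_irrefl)
  \<comment> \<open>Stated for an arbitrary right-hand side: zero yields injectivity of
    \<open>?A\<close>, and a general \<open>b\<close> with \<open>x\<close> its image under
    \<open>Hinv\<close> yields the formula for the inverse.\<close>
  have vel: "of_real (x $\<^sub>v entry ?N c i) = idft ns (\<lambda>q. dft ns (\<lambda>j. of_real (b $\<^sub>v entry ?N c j)) q / ?g q) i"
    if x: "x \<in> carrier_vec (4 * ?N)" and eq: "?A *\<^sub>v x = b" and i: "i < ?N" and c: "c < 3" for x b c i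
    by (rule idft_eq_multiplier_iff[where u = "\<lambda>j. of_real (x $\<^sub>v entry ?N c j)", OF ns g _ i])
      (simp only: eq[symmetric] shifted_calH_mult(2)[OF ns x _ c])
  have mult: "x $\<^sub>v entry ?N 3 i = b $\<^sub>v entry ?N 3 i / lam"
    if x: "x \<in> carrier_vec (4 * ?N)" and eq: "?A *\<^sub>v x = b" and i: "i < ?N" for x b i
    using shifted_calH_mult(1)[OF ns x i, of lam Ls \<alpha> \<theta> k Cexc] pos(3) unfolding eq by simp
  have "x = 0\<^sub>v (4 * ?N)" if x: "x \<in> carrier_vec (4 * ?N)" and 0: "?A *\<^sub>v x = 0\<^sub>v (4 * ?N)" for x
  proof (rule vec_eq_entryI[OF x])
    fix c i :: nat assume c: "c < 4" and i: "i < ?N"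
    have zero: "0\<^sub>v (4 * ?N) $\<^sub>v entry ?N c j = (0::real)" if "j < ?N" for j
      using entry_less[OF c that] by simp
    show "x $\<^sub>v entry ?N c i = 0\<^sub>v (4 * ?N) $\<^sub>v entry ?N c i"
    proof (cases "c = 3")
      case True
      then show ?thesis using mult[OF x 0 i] zero[OF i] by simp
    next
      case False
      then have "complex_of_real (x $\<^sub>v entry ?N c i) = 0"
        using vel[OF x 0 i, of c] c by (simp add: dft_def idft_def zero)
      then show ?thesis using zero[OF i] by simp
    qed
  qed simp
  then obtain Hinv where Hinv: "mat_inverse ?A = Some Hinv"
    using mat_inverse_ex_if_inj[OF A] by blast
  note Hinv_mult = mat_inverse_SomeD(1,4)[OF A Hinv]
  have "Hinv *\<^sub>v b \<in> carrier_vec (4 * ?N)" if "b \<in> carrier_vec (4 * ?N)" for b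
    using Hinv_mult(1) that by auto
  then show ?thesis
    using that[OF Hinv] vel mult Hinv_mult(2) by blast
qed

section \<open>Correctness of the program\<close>

definition writes :: "nat \<Rightarrow> instr list \<Rightarrow> cell set" where
  "writes N prog = (\<Union>ins\<in>set prog. instr_writes N ins)"

lemma writes_simps [simp]:
  "writes N [] = {}"
  "writes N (ins # prog) = instr_writes N ins \<union> writes N prog"
  "writes N (prog @ prog') = writes N prog \<union> writes N prog'"
  "writes N (concat progs) = (\<Union>prog\<in>set progs. writes N prog)"
  "writes N (map f xs) = (\<Union>x\<in>set xs. instr_writes N (f x))"
  by (auto simp: writes_def)

lemma run_simps [simp]:
  "run ns [] s = s"
  "run ns (ins # prog) s = run ns prog (exec ns ins s)"
  "run ns (prog @ prog') s = run ns prog' (run ns prog s)"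
  by (simp_all add: run_def)

lemma exec_unwritten: "x \<notin> instr_writes (Ng ns) ins \<Longrightarrow> exec ns ins s x = s x"
  by (cases ins; cases x) (auto simp: store_array_def)

lemma run_unwritten: "x \<notin> writes (Ng ns) prog \<Longrightarrow> run ns prog s x = s x"
  by (induction prog arbitrary: s) (simp_all add: exec_unwritten)

text \<open>Later iterations do not touch \<open>x\<close>, and earlier ones matter only through the
  state in which iteration \<open>i\<close> starts.\<close>

lemma run_concat_upt:
  assumes "i < n" "\<And>j. i < j \<Longrightarrow> j < n \<Longrightarrow> x \<notin> writes (Ng ns) (p j)"
  shows "run ns (concat (map p [0..<n])) s x = run ns (p i) (run ns (concat (map p [0..<i])) s) x"
proof -
  have "[0..<n] = [0..<i] @ i # [Suc i..<n]"
    using assms(1) by (metis less_imp_add_positive less_imp_le_nat upt_add_eq_append upt_conv_Cons zero_le)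
  moreover have "x \<notin> writes (Ng ns) (concat (map p [Suc i..<n]))"
    using assms(2) by auto
  ultimately show ?thesis
    by (simp add: run_unwritten del: writes_simps(4))
qed

lemma run_concat_upt_unwritten:
  "(\<And>j. j < n \<Longrightarrow> x \<notin> writes (Ng ns) (p j)) \<Longrightarrow> run ns (concat (map p [0..<n])) s x = s x"
  by (rule run_unwritten) auto

section \<open>The Fourier-space solve\<close>

lemma writes_symbol_prog: "writes N (symbol_prog ns q) \<subseteq> {tmp 2, tmp 3}"
  by (auto simp: symbol_prog_def)

lemma run_symbol_prog:
  assumes "s (TwoPi, 0) = of_real (2 * pi)" "\<And>l. l < length ns \<Longrightarrow> s (Len, l) = of_real (Ls ! l)"
    and "s (tmp 0) = of_real a" "s (tmp 1) = of_real b"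
  shows "run ns (symbol_prog ns q) s (tmp 2) = of_real (wave_norm_sq ns Ls q * b + a)"
proof -
  define p where "p = (\<lambda>l. [Lit (tmp 3) (wavenum ns q l),
          Op (tmp 3) (tmp 3) Times (TwoPi, 0),
          Op (tmp 3) (tmp 3) Divide (Len, l),
          Op (tmp 3) (tmp 3) Times (tmp 3),
          Op (tmp 2) (tmp 2) Plus (tmp 3)])"
  have p_writes: "x \<notin> writes (Ng ns) (p l)" if "x \<noteq> tmp 2" "x \<noteq> tmp 3" for x l
    using that by (simp add: p_def)
  note preserved = run_concat_upt_unwritten[of _ _ ns p, OF p_writes]
  \<comment> \<open>Generalized to the first \<open>n\<close> directions and any starting value of
    \<open>tmp 2\<close>, for induction on \<open>n\<close>.\<close>
  have loop: "run ns (concat (map p [0..<n])) t (tmp 2)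
      = t (tmp 2) + of_real (\<Sum>l<n. (wave_vector ns Ls q l)\<^sup>2)"
    if "n \<le> length ns" "t (TwoPi, 0) = of_real (2 * pi)"
      "\<And>l. l < length ns \<Longrightarrow> t (Len, l) = of_real (Ls ! l)" for n t
    using that(1)
  proof (induction n)
    case (Suc n)
    let ?t = "run ns (concat (map p [0..<n])) t"
    have "?t (TwoPi, 0) = of_real (2 * pi)" "?t (Len, n) = of_real (Ls ! n)"
      using Suc.prems that(2,3) by (simp_all add: preserved)
    then have "run ns (p n) ?t (tmp 2) = ?t (tmp 2) + of_real ((wave_vector ns Ls q n)\<^sup>2)"
      by (simp add: p_def wave_vector_def power2_eq_square mult_ac)
    then show ?case
      using Suc by simp
  qed simp
  let ?s = "s(tmp 2 := 0)"
  let ?t = "run ns (concat (map p [0..<length ns])) ?s"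
  have "?t (tmp 2) = of_real (wave_norm_sq ns Ls q)"
    by (subst loop) (simp_all add: assms wave_norm_sq_def)
  moreover have "?t (tmp 0) = of_real a" "?t (tmp 1) = of_real b"
    using assms(3,4) by (simp_all add: preserved)
  ultimately show ?thesis
    unfolding symbol_prog_def p_def[symmetric] by simp
qed

text \<open>Names the loop body that \<open>H_solve\<close> spells out, so that the loop lemmas can
  be applied to it.\<close>

definition mode_solve :: "nat list \<Rightarrow> nat \<Rightarrow> instr list" where
  "mode_solve ns q = symbol_prog ns q
     @ [Op (Aux 0, q) (Aux 0, q) Divide (tmp 2),
        Op (Aux 1, q) (Aux 1, q) Divide (tmp 2),
        Op (Aux 2, q) (Aux 2, q) Divide (tmp 2)]"

lemma writes_mode_solve:
  "writes N (mode_solve ns q) \<subseteq> {tmp 2, tmp 3} \<union> Aux ` {..<3} \<times> {q}"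
  using writes_symbol_prog[of N ns q] by (auto simp: mode_solve_def)

lemma less_3_cases: "c < 3 \<Longrightarrow> c = 0 \<or> c = 1 \<or> c = 2" for c :: nat
  by auto

lemma run_mode_solves:
  assumes s: "s (TwoPi, 0) = of_real (2 * pi)" "\<And>l. l < length ns \<Longrightarrow> s (Len, l) = of_real (Ls ! l)"
      "s (tmp 0) = of_real a" "s (tmp 1) = of_real b"
    and q: "q < n" and c: "c < 3"
  shows "run ns (concat (map (mode_solve ns) [0..<n])) s (Aux c, q)
    = s (Aux c, q) / of_real (wave_norm_sq ns Ls q * b + a)"
proof -
  let ?s = "run ns (concat (map (mode_solve ns) [0..<q])) s"
  let ?t = "run ns (symbol_prog ns q) ?s"
  \<comment> \<open>Iterations before \<open>q\<close> change only scratch cells and modes below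
    \<open>q\<close>, so mode \<open>q\<close> still holds its original coefficient.\<close>
  have preserved: "?s x = s x" if "x \<notin> {tmp 2, tmp 3} \<union> Aux ` {..<3} \<times> {..<q}" for x
    by (rule run_concat_upt_unwritten) (use writes_mode_solve[of "Ng ns" ns] that in blast)
  have "?t (tmp 2) = of_real (wave_norm_sq ns Ls q * b + a)"
    by (rule run_symbol_prog) (use s in \<open>auto simp: preserved image_iff\<close>)
  moreover have "?t (Aux c', q) = s (Aux c', q)" for c'
  proof -
    have "?t (Aux c', q) = ?s (Aux c', q)"
      by (rule run_unwritten) (use writes_symbol_prog[of "Ng ns" ns q] in auto)
    then show ?thesis by (auto simp: preserved image_iff)
  qed
  ultimately have "run ns (mode_solve ns q) ?s (Aux c, q) = s (Aux c, q) / of_real (wave_norm_sq ns Ls q * b + a)"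
    using less_3_cases[OF c] by (auto simp: mode_solve_def)
  then show ?thesis
    by (subst run_concat_upt[OF q]) (use writes_mode_solve[of "Ng ns" ns] in auto)
qed

text \<open>Brings the one-instruction loop for the multiplier into the form of
  \<open>run_concat_upt\<close>.\<close>

lemma map_eq_concat: "map f xs = concat (map (\<lambda>x. [f x]) xs)"
  by (induction xs) simp_all

lemma writes_H_solve: "writes (Ng ns) (H_solve ns) \<subseteq> tmp ` {..<4} \<union> Aux ` {..<4} \<times> {..<Ng ns}"
proof -
  have "writes (Ng ns) (concat (map (mode_solve ns) [0..<Ng ns]))
      \<subseteq> tmp ` {..<4} \<union> Aux ` {..<4} \<times> {..<Ng ns}"
    by (auto dest!: subsetD[OF writes_mode_solve])
  then show ?thesis
    unfolding H_solve_def mode_solve_def[symmetric] writes_simps(1-3,5) instr_writes.simps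
    by (intro Un_least) auto
qed

lemma run_H_solve:
  assumes "loaded ns Ls \<alpha> \<theta> k Cexc ms lam b s" "i < Ng ns"
  shows "c < 3 \<Longrightarrow> run ns (H_solve ns) s (Aux c, i)
      = idft ns (\<lambda>q. dft ns (\<lambda>j. of_real (b $\<^sub>v entry (Ng ns) c j)) q
          / of_real (\<alpha> + \<theta> * k * Cexc * wave_norm_sq ns Ls q + lam)) i"
    and "run ns (H_solve ns) s (Aux 3, i) = of_real (b $\<^sub>v entry (Ng ns) 3 i / lam)"
proof -
  let ?N = "Ng ns"
  define p1 where "p1 = [Op (tmp 0) (Alpha, 0) Plus (Lam, 0),
      Op (tmp 1) (Theta, 0) Times (K, 0),
      Op (tmp 1) (tmp 1) Times (Cex, 0),
      Fft (Aux 0) (Rhs 0), Fft (Aux 1) (Rhs 1), Fft (Aux 2) (Rhs 2)]"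
  \<comment> \<open>The phases of the solve: \<open>s1\<close> follows the setup and the forward
    transforms, \<open>s2\<close> the division at every mode, \<open>s3\<close> the inverse
    transforms.\<close>
  define s1 where "s1 = run ns p1 s"
  define s2 where "s2 = run ns (concat (map (mode_solve ns) [0..<?N])) s1"
  define s3 where "s3 = run ns [Ifft (Aux 0) (Aux 0), Ifft (Aux 1) (Aux 1), Ifft (Aux 2) (Aux 2)] s2"
  define p4 where "p4 = (\<lambda>i. [Op (Aux 3, i) (Rhs 3, i) Divide (Lam, 0)])"
  have run: "run ns (H_solve ns) s = run ns (concat (map p4 [0..<?N])) s3"
    unfolding H_solve_def mode_solve_def[symmetric] map_eq_concat[of "\<lambda>i. Op (Aux 3, i) (Rhs 3, i) Divide (Lam, 0)"]
      s3_def s2_def s1_def p1_def p4_def by simp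
  note loaded = assms(1)[unfolded loaded_def]
  have s1: "s1 (TwoPi, 0) = of_real (2 * pi)" "\<And>l. l < length ns \<Longrightarrow> s1 (Len, l) = of_real (Ls ! l)"
      "s1 (tmp 0) = of_real (\<alpha> + lam)" "s1 (tmp 1) = of_real (\<theta> * k * Cexc)"
    using loaded by (simp_all add: s1_def p1_def store_array_def)
  \<comment> \<open>The three transforms write distinct arrays and leave \<open>Rhs\<close> intact,
    so each reads the loaded data.\<close>
  have s1_Aux: "s1 (Aux c, q) = dft ns (\<lambda>j. of_real (b $\<^sub>v entry ?N c j)) q" if "q < ?N" "c < 3" for c q :: nat
  proof -
    have "s1 (Aux c, q) = dft ns (\<lambda>j. s (Rhs c, j)) q"
      using less_3_cases[OF that(2)] that(1) by (auto simp: s1_def p1_def store_array_def)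
    moreover have "dft ns (\<lambda>j. s (Rhs c, j)) = dft ns (\<lambda>j. of_real (b $\<^sub>v entry ?N c j))"
      by (rule dft_cong) (use loaded that(2) in auto)
    ultimately show ?thesis by simp
  qed
  show "run ns (H_solve ns) s (Aux c, i)
      = idft ns (\<lambda>q. dft ns (\<lambda>j. of_real (b $\<^sub>v entry (Ng ns) c j)) q
          / of_real (\<alpha> + \<theta> * k * Cexc * wave_norm_sq ns Ls q + lam)) i" if c: "c < 3"
  proof -
    have "run ns (H_solve ns) s (Aux c, i) = s3 (Aux c, i)"
      unfolding run by (rule run_concat_upt_unwritten) (use c in \<open>simp add: p4_def\<close>)
    also have "\<dots> = idft ns (\<lambda>q. s2 (Aux c, q)) i"
      using less_3_cases[OF c] assms(2) by (auto simp: s3_def store_array_def)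
    also have "idft ns (\<lambda>q. s2 (Aux c, q)) = idft ns (\<lambda>q. dft ns (\<lambda>j. of_real (b $\<^sub>v entry (Ng ns) c j)) q
          / of_real (\<alpha> + \<theta> * k * Cexc * wave_norm_sq ns Ls q + lam))"
      unfolding s2_def
      by (rule idft_cong) (simp add: run_mode_solves[OF s1 _ c] s1_Aux c algebra_simps)
    finally show ?thesis .
  qed
  have "s3 (a, j) = s (a, j)" if "\<And>n. a \<noteq> Aux n" "\<And>n. a \<noteq> Tmp n" for a j
  proof -
    have "s3 (a, j) = s2 (a, j)"
      unfolding s3_def by (rule run_unwritten) (use that in auto)
    also have "\<dots> = s1 (a, j)"
      unfolding s2_def by (rule run_concat_upt_unwritten) (use that in \<open>auto dest!: subsetD[OF writes_mode_solve]\<close>)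
    also have "\<dots> = s (a, j)"
      unfolding s1_def p1_def by (rule run_unwritten) (use that in auto)
    finally show ?thesis .
  qed
  moreover have "run ns (concat (map p4 [0..<i])) s3 (a, j) = s3 (a, j)" if "\<And>n. a \<noteq> Aux n" for a j
    by (rule run_concat_upt_unwritten) (use that in \<open>simp add: p4_def\<close>)
  moreover have "run ns (H_solve ns) s (Aux 3, i) = run ns (p4 i) (run ns (concat (map p4 [0..<i])) s3) (Aux 3, i)"
    unfolding run by (rule run_concat_upt[OF assms(2)]) (simp add: p4_def)
  ultimately show "run ns (H_solve ns) s (Aux 3, i) = of_real (b $\<^sub>v entry (Ng ns) 3 i / lam)"
    using loaded assms(2) by (simp add: p4_def)
qed

section \<open>The node-local solve and the complete program\<close>

lemma writes_node_solve: "writes N (node_solve i) \<subseteq> {tmp 0, tmp 1} \<union> Sol ` {..<4} \<times> {i}"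
  by (auto simp: node_solve_def add_product_def Let_def)

lemma writes_S_solve: "writes N (S_solve N') \<subseteq> {tmp 0, tmp 1} \<union> Sol ` {..<4} \<times> {..<N'}"
  unfolding S_solve_def by (auto dest!: subsetD[OF writes_node_solve])

lemma run_node_solve:
  assumes "s (Lam, 0) = of_real lam" "\<And>c :: nat. c < 3 \<Longrightarrow> s (Mag c, i) = of_real (m $ comp3 c)"
    and "\<And>c :: nat. c < 4 \<Longrightarrow> s (Aux c, i) = of_real (y $\<^sub>v entry N c i)" and c: "c < 4"
  shows "run ns (node_solve i) s (Sol c, i) = of_real
    ((((1 / (lam\<^sup>2 + (norm m)\<^sup>2)) *\<^sub>R (lam *\<^sub>R mat 1 - S_tilde m)) *v node_vec N y i) $ of_nat (Suc c))"
proof -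
  have "s (Mag 0, i) = of_real (m$1)" "s (Mag (Suc 0), i) = of_real (m$2)" "s (Mag 2, i) = of_real (m$3)"
    using assms(2)[of 0] assms(2)[of 1] assms(2)[of 2] by (simp_all add: comp3_def)
  moreover have "s (Aux 0, i) = of_real (y $\<^sub>v entry N 0 i)" "s (Aux (Suc 0), i) = of_real (y $\<^sub>v entry N 1 i)"
    "s (Aux 2, i) = of_real (y $\<^sub>v entry N 2 i)" "s (Aux 3, i) = of_real (y $\<^sub>v entry N 3 i)"
    using assms(3)[of 0] assms(3)[of 1] assms(3)[of 2] assms(3)[of 3] by simp_all
  \<comment> \<open>\<open>D\<close> is the value accumulated in \<open>tmp 0\<close>, the common
    denominator of the four rows.\<close>
  moreover define D where "D = lam\<^sup>2 + (norm m)\<^sup>2"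
  then have "complex_of_real lam * of_real lam + of_real (m$1) * of_real (m$1)
      + of_real (m$2) * of_real (m$2) + of_real (m$3) * of_real (m$3) = of_real D"
    by (simp add: power2_eq_square norm_mult_self_3)
  ultimately show ?thesis
    unfolding D_def[symmetric] using less_4_cases[OF c] assms(1)
    by (elim disjE)
      (simp_all add: node_solve_def Let_def add_product_def matrix_vector_mult_def sum_4 node_vec_def
        vector_4 Finite_Cartesian_Product.mat_def add_divide_distrib diff_divide_distrib)
qed

lemma run_S_solve:
  assumes "s (Lam, 0) = of_real lam"
    and "\<And>(c::nat) i. c < 3 \<Longrightarrow> i < N \<Longrightarrow> s (Mag c, i) = of_real (ms i $ comp3 c)"
    and "\<And>(c::nat) i. c < 4 \<Longrightarrow> i < N \<Longrightarrow> s (Aux c, i) = of_real (y $\<^sub>v entry N c i)"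
    and i: "i < N" and c: "c < 4"
  shows "run ns (S_solve N) s (Sol c, i) = of_real
    ((((1 / (lam\<^sup>2 + (norm (ms i))\<^sup>2)) *\<^sub>R (lam *\<^sub>R mat 1 - S_tilde (ms i))) *v node_vec N y i) $ of_nat (Suc c))"
proof -
  let ?s = "run ns (concat (map node_solve [0..<i])) s"
  have preserved: "?s (a, j) = s (a, j)" if "\<And>n. a \<noteq> Sol n" "\<And>n. a \<noteq> Tmp n" for a j
    by (rule run_concat_upt_unwritten) (use that in \<open>auto dest!: subsetD[OF writes_node_solve]\<close>)
  have "run ns (S_solve N) s (Sol c, i) = run ns (node_solve i) ?s (Sol c, i)"
    unfolding S_solve_def
    by (rule run_concat_upt[OF i]) (auto dest!: subsetD[OF writes_node_solve])
  also have "\<dots> = of_real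
    ((((1 / (lam\<^sup>2 + (norm (ms i))\<^sup>2)) *\<^sub>R (lam *\<^sub>R mat 1 - S_tilde (ms i))) *v node_vec N y i) $ of_nat (Suc c))"
    by (rule run_node_solve) (use assms in \<open>auto simp: preserved\<close>)
  finally show ?thesis .
qed

lemma node_vec_nth: "c < 4 \<Longrightarrow> node_vec N y i $ of_nat (Suc c) = y $\<^sub>v entry N c i"
  by (drule less_4_cases) (auto simp: node_vec_def vector_4)

text \<open>Inverting the product reverses its factors, which is the order of the program:
  \<open>H_solve\<close> leaves \<open>Hinv *\<^sub>v b\<close> in \<open>Aux\<close>, and
  \<open>S_solve\<close> acts on that vector.\<close>

lemma precond_solve_correct:
  fixes ms :: "nat \<Rightarrow> real^3"
  assumes ns: "\<forall>n\<in>set ns. 0 < n"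
    and pos: "0 < \<alpha>" "\<theta> \<in> {1, 1 / 2}" "0 < k" "0 < Cexc" "0 < lam"
  shows "(\<exists>Hinv Sinv.
       mat_inverse (shifted lam (calH ns Ls \<alpha> \<theta> k Cexc)) = Some Hinv \<and>
       mat_inverse (shifted lam (calS (Ng ns) ms)) = Some Sinv \<and>
       mat_inverse (precond ns Ls \<alpha> \<theta> k Cexc ms lam) = Some (Sinv * Hinv) \<and>
       (\<forall>b \<in> carrier_vec (4 * Ng ns). \<forall>i < Ng ns.
          (\<forall>c<3. of_real ((Hinv *\<^sub>v b) $\<^sub>v entry (Ng ns) c i)
             = idft ns (\<lambda>q. dft ns (\<lambda>j. of_real (b $\<^sub>v entry (Ng ns) c j)) q
                 / of_real (\<alpha> + \<theta> * k * Cexc * wave_norm_sq ns Ls q + lam)) i) \<and>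
          (Hinv *\<^sub>v b) $\<^sub>v entry (Ng ns) 3 i = b $\<^sub>v entry (Ng ns) 3 i / lam \<and>
          node_vec (Ng ns) (Sinv *\<^sub>v b) i
            = ((1 / (lam\<^sup>2 + (norm (ms i))\<^sup>2)) *\<^sub>R (lam *\<^sub>R mat 1 - S_tilde (ms i)))
              *v node_vec (Ng ns) b i) \<and>
       (\<forall>b \<in> carrier_vec (4 * Ng ns). \<forall>s.
          loaded ns Ls \<alpha> \<theta> k Cexc ms lam b s \<longrightarrow>
          holds (Ng ns) Aux (Hinv *\<^sub>v b) (run ns (H_solve ns) s) \<and>
          holds (Ng ns) Sol ((Sinv * Hinv) *\<^sub>v b) (run ns (precond_solve ns) s)))"
proof -
  let ?N = "Ng ns"
  have nonneg: "0 \<le> \<theta> * k * Cexc"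
    using pos by auto
  obtain Hinv where Hinv: "mat_inverse (shifted lam (calH ns Ls \<alpha> \<theta> k Cexc)) = Some Hinv"
    and vel: "\<And>b i c. b \<in> carrier_vec (4 * ?N) \<Longrightarrow> i < ?N \<Longrightarrow> c < 3 \<Longrightarrow>
      of_real ((Hinv *\<^sub>v b) $\<^sub>v entry ?N c i)
        = idft ns (\<lambda>q. dft ns (\<lambda>j. of_real (b $\<^sub>v entry ?N c j)) q
            / of_real (\<alpha> + \<theta> * k * Cexc * wave_norm_sq ns Ls q + lam)) i"
    and mult: "\<And>b i. b \<in> carrier_vec (4 * ?N) \<Longrightarrow> i < ?N \<Longrightarrow>
      (Hinv *\<^sub>v b) $\<^sub>v entry ?N 3 i = b $\<^sub>v entry ?N 3 i / lam"
    using mat_inverse_shifted_calH[OF ns pos(1) nonneg pos(5)] by blast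
  obtain Sinv where Sinv: "mat_inverse (shifted lam (calS ?N ms)) = Some Sinv"
    and nodal: "\<And>b i. b \<in> carrier_vec (4 * ?N) \<Longrightarrow> i < ?N \<Longrightarrow> node_vec ?N (Sinv *\<^sub>v b) i
      = ((1 / (lam\<^sup>2 + (norm (ms i))\<^sup>2)) *\<^sub>R (lam *\<^sub>R mat 1 - S_tilde (ms i))) *v node_vec ?N b i"
    using mat_inverse_shifted_calS[OF pos(5)] by blast
  note carrier = mat_inverse_SomeD(1)[OF shifted_carrier[OF calH_carrier] Hinv]
    mat_inverse_SomeD(1)[OF shifted_carrier[OF calS_carrier] Sinv]
  have inverse: "mat_inverse (precond ns Ls \<alpha> \<theta> k Cexc ms lam) = Some (Sinv * Hinv)"
    unfolding precond_def
    by (rule mat_inverse_mult[OF shifted_carrier[OF calH_carrier] Hinv shifted_carrier[OF calS_carrier] Sinv])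
  have program: "holds ?N Aux (Hinv *\<^sub>v b) (run ns (H_solve ns) s)"
    "holds ?N Sol ((Sinv * Hinv) *\<^sub>v b) (run ns (precond_solve ns) s)"
    if b: "b \<in> carrier_vec (4 * ?N)" and s: "loaded ns Ls \<alpha> \<theta> k Cexc ms lam b s" for b s
  proof -
    let ?s = "run ns (H_solve ns) s"
    have Hb: "Hinv *\<^sub>v b \<in> carrier_vec (4 * ?N)"
      using carrier(1) b by simp
    have Aux: "?s (Aux c, i) = of_real ((Hinv *\<^sub>v b) $\<^sub>v entry ?N c i)" if "c < 4" "i < ?N" for c i :: nat
    proof (cases "c < 3")
      case True
      then show ?thesis using run_H_solve(1)[OF s that(2)] vel[OF b that(2)] by simp
    next
      case False
      then have "c = 3" using that(1) by simp
      then show ?thesis using run_H_solve(2)[OF s that(2)] mult[OF b that(2)] by simp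
    qed
    then show "holds ?N Aux (Hinv *\<^sub>v b) ?s"
      by (simp add: holds_def)
    \<comment> \<open>The first phase writes only \<open>Aux\<close> and scratch cells, so the
      second still finds \<open>Lam\<close> and \<open>Mag\<close> as loaded.\<close>
    have preserved: "?s (a, j) = s (a, j)" if "\<And>n. a \<noteq> Aux n" "\<And>n. a \<noteq> Tmp n" for a j
      by (rule run_unwritten) (use that in \<open>auto dest!: subsetD[OF writes_H_solve]\<close>)
    have "run ns (precond_solve ns) s (Sol c, i) = of_real ((Sinv *\<^sub>v (Hinv *\<^sub>v b)) $\<^sub>v entry ?N c i)"
      if "c < 4" "i < ?N" for c i :: nat
    proof -
      have "run ns (precond_solve ns) s (Sol c, i) = of_real (node_vec ?N (Sinv *\<^sub>v (Hinv *\<^sub>v b)) i $ of_nat (Suc c))"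
        unfolding precond_solve_def run_simps nodal[OF Hb that(2)]
        by (rule run_S_solve[OF _ _ Aux that(2,1)])
          (use s in \<open>auto simp: loaded_def preserved\<close>)
      then show ?thesis by (simp only: node_vec_nth[OF that(1)])
    qed
    then show "holds ?N Sol ((Sinv * Hinv) *\<^sub>v b) (run ns (precond_solve ns) s)"
      using assoc_mult_mat_vec[OF carrier(2,1) b] by (simp add: holds_def)
  qed
  from Hinv Sinv inverse vel mult nodal program show ?thesis
    by (intro exI[of _ Hinv] exI[of _ Sinv] conjI ballI allI impI)
qed

section \<open>Operation count and storage\<close>

lemma ops_simps [simp]:
  "ops F N [] = 0"
  "ops F N (ins # prog) = instr_ops F N ins + ops F N prog"
  "ops F N (prog @ prog') = ops F N prog + ops F N prog'"
  by (simp_all add: ops_def)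

lemma ops_concat: "ops F N (concat progs) = sum_list (map (ops F N) progs)"
  by (induction progs) simp_all

lemma ops_symbol_prog: "ops F N (symbol_prog ns q) = 5 * length ns + 3"
  by (simp add: symbol_prog_def ops_concat comp_def sum_list_triv)

lemma ops_mode_solve: "ops F N (mode_solve ns q) = 5 * length ns + 6"
  by (simp add: mode_solve_def ops_symbol_prog)

lemma ops_node_solve: "ops F N (node_solve i) = 39"
  by (simp add: node_solve_def add_product_def Let_def)

lemma ops_map_Op: "ops F N (map (\<lambda>i. Op (x i) (y i) f (z i)) is) = length is"
  by (induction "is") simp_all

text \<open>Three forward and three inverse transforms give \<open>6 * F N\<close>. Each mode costs
  \<open>5 * length ns + 6\<close>; each node costs 39 for the local solve and 1 for the multiplier
  division. The setup takes 3 operations.\<close>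

lemma ops_precond_solve:
  "ops F N (precond_solve ns) = 6 * F N + (5 * length ns + 46) * Ng ns + 3"
  unfolding precond_solve_def H_solve_def mode_solve_def[symmetric] S_solve_def
  by (simp add: ops_concat comp_def sum_list_triv ops_mode_solve ops_node_solve ops_map_Op algebra_simps)

lemma storage_precond_solve: "storage W (Ng ns) (precond_solve ns) \<le> 8 * Ng ns + 4 + W (Ng ns)"
proof -
  let ?N = "Ng ns"
  have "writes ?N (precond_solve ns)
      \<subseteq> tmp ` {..<4} \<union> (Aux ` {..<4} \<times> {..<?N} \<union> Sol ` {..<4} \<times> {..<?N})" (is "_ \<subseteq> ?C")
    using writes_H_solve[of ns] writes_S_solve[of ?N ?N] by (auto simp: precond_solve_def)
  then have "card (writes ?N (precond_solve ns)) \<le> card ?C"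
    by (intro card_mono) simp_all
  also have "\<dots> \<le> card (tmp ` {..<4}) + (card (Aux ` {..<4} \<times> {..<?N}) + card (Sol ` {..<4} \<times> {..<?N}))"
    by (intro order.trans[OF card_Un_le] add_left_mono card_Un_le)
  also have "\<dots> \<le> 8 * ?N + 4"
    by (simp add: card_cartesian_product card_image inj_on_def)
  finally have "card (writes ?N (precond_solve ns)) \<le> 8 * ?N + 4" .
  moreover have "instr_workspace W ?N ins \<le> W ?N" for ins
    by (cases ins) simp_all
  then have "Max (insert 0 (instr_workspace W ?N ` set (precond_solve ns))) \<le> W ?N"
    by auto
  ultimately show ?thesis
    unfolding storage_def writes_def[symmetric] by linarith
qed

section \<open>Asymptotic bounds and the final statement\<close>

lemma linear_in_bigo_linearithmic: "(\<lambda>n. real n) \<in> O(\<lambda>n. real n * ln (real n))"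
proof (rule bigoI[where c = 1])
  \<comment> \<open>The threshold 3 comes from \<open>exp 1\<close> being at most 3.\<close>
  have "1 \<le> ln (real n)" if "3 \<le> n" for n
    using that exp_le by (subst ln_ge_iff) auto
  then have "real n \<le> real n * ln (real n)" if "3 \<le> n" for n
    using that mult_left_mono[of 1 "ln (real n)" "real n"] by simp
  then show "\<forall>\<^sub>F n in sequentially. norm (real n) \<le> 1 * norm (real n * ln (real n))"
    by (intro eventually_sequentiallyI[of 3]) force
qed

lemma const_in_bigo_linear: "(\<lambda>n. c) \<in> O(\<lambda>n. real n)" for c :: real
  by (rule bigoI[where c = "\<bar>c\<bar>"])
    (auto intro!: eventually_sequentiallyI[of 1] simp: mult_le_cancel_left1)

text \<open>The dimension \<open>d\<close> is fixed before \<open>T\<close> and \<open>M\<close>: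
  the cost per mode grows with the number of directions, while the bounds may depend on the grid
  only through its number of nodes.\<close>

theorem mainTheorem8:
  fixes F W :: "nat \<Rightarrow> nat" and d :: nat
  assumes fft_ops: "(\<lambda>n. real (F n)) \<in> O(\<lambda>n. real n * ln (real n))"
    and fft_workspace: "(\<lambda>n. real (W n)) \<in> O(\<lambda>n. real n)"
    and dim: "0 < d"
  shows
    "(\<forall>(m :: real^3) lam :: real. 0 < lam \<longrightarrow>
        S_tilde m ** S_tilde m = - ((norm m)\<^sup>2 *\<^sub>R mat 1) \<and>
        transpose (lam *\<^sub>R mat 1 + S_tilde m) ** (lam *\<^sub>R mat 1 + S_tilde m)
          = (lam\<^sup>2 + (norm m)\<^sup>2) *\<^sub>R mat 1 \<and>
        invertible (lam *\<^sub>R mat 1 + S_tilde m) \<and>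
        kappa\<^sub>2 (lam *\<^sub>R mat 1 + S_tilde m) = 1 \<and>
        spectral_norm (matrix_inv (lam *\<^sub>R mat 1 + S_tilde m))
          = (lam\<^sup>2 + (norm m)\<^sup>2) powr (- (1 / 2)) \<and>
        matrix_inv (lam *\<^sub>R mat 1 + S_tilde m)
          = (1 / (lam\<^sup>2 + (norm m)\<^sup>2)) *\<^sub>R (lam *\<^sub>R mat 1 - S_tilde m) \<and>
        (let p1 = m$1 / lam; p2 = m$2 / lam; p3 = m$3 / lam in
          matrix_inv (lam *\<^sub>R mat 1 + S_tilde m)
            = (1 / (lam * (p1\<^sup>2 + p2\<^sup>2 + p3\<^sup>2 + 1))) *\<^sub>R
              vector [vector [1, p3, - p2, - p1],
                      vector [- p3, 1, p1, - p2],
                      vector [p2, - p1, 1, - p3],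
                      vector [p1, p2, p3, 1]])) \<and>
     (\<exists>T M :: nat \<Rightarrow> nat.
        (\<lambda>n. real (T n)) \<in> O(\<lambda>n. real n * ln (real n)) \<and>
        (\<lambda>n. real (M n)) \<in> O(\<lambda>n. real n) \<and>
        (\<forall>ns Ls \<alpha> \<theta> k Cexc lam. \<forall>ms :: nat \<Rightarrow> real^3.
           periodic_grid d ns Ls \<longrightarrow> 0 < \<alpha> \<longrightarrow> \<theta> \<in> {1, 1 / 2} \<longrightarrow> 0 < k \<longrightarrow> 0 < Cexc \<longrightarrow> 0 < lam \<longrightarrow>
           ops F (Ng ns) (precond_solve ns) \<le> T (Ng ns) \<and>
           storage W (Ng ns) (precond_solve ns) \<le> M (Ng ns) \<and>
           (\<exists>Hinv Sinv.
              mat_inverse (shifted lam (calH ns Ls \<alpha> \<theta> k Cexc)) = Some Hinv \<and>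
              mat_inverse (shifted lam (calS (Ng ns) ms)) = Some Sinv \<and>
              mat_inverse (precond ns Ls \<alpha> \<theta> k Cexc ms lam) = Some (Sinv * Hinv) \<and>
              (\<forall>b \<in> carrier_vec (4 * Ng ns). \<forall>i < Ng ns.
                 (\<forall>c<3. of_real ((Hinv *\<^sub>v b) $\<^sub>v entry (Ng ns) c i)
                    = idft ns (\<lambda>q. dft ns (\<lambda>j. of_real (b $\<^sub>v entry (Ng ns) c j)) q
                        / of_real (\<alpha> + \<theta> * k * Cexc * wave_norm_sq ns Ls q + lam)) i) \<and>
                 (Hinv *\<^sub>v b) $\<^sub>v entry (Ng ns) 3 i = b $\<^sub>v entry (Ng ns) 3 i / lam \<and>
                 node_vec (Ng ns) (Sinv *\<^sub>v b) i
                   = ((1 / (lam\<^sup>2 + (norm (ms i))\<^sup>2)) *\<^sub>R (lam *\<^sub>R mat 1 - S_tilde (ms i)))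
                     *v node_vec (Ng ns) b i) \<and>
              (\<forall>b \<in> carrier_vec (4 * Ng ns). \<forall>s.
                 loaded ns Ls \<alpha> \<theta> k Cexc ms lam b s \<longrightarrow>
                 holds (Ng ns) Aux (Hinv *\<^sub>v b) (run ns (H_solve ns) s) \<and>
                 holds (Ng ns) Sol ((Sinv * Hinv) *\<^sub>v b) (run ns (precond_solve ns) s)))))"
  (is "?local \<and> ?global")
proof
  show ?local
    unfolding Let_def
    using S_tilde_square transpose_shifted_S_tilde shifted_S_tilde_products(1)
      matrix_inv_shifted_S_tilde(1) kappa\<^sub>2_shifted_S_tilde
      spectral_norm_shifted_S_tilde(2) matrix_inv_shifted_S_tilde(2) matrix_inv_shifted_S_tilde_scaled
    by (simp add: powr_minus_divide powr_half_sqrt real_sqrt_divide)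
  define T where "T n = 6 * F n + (5 * d + 46) * n + 3" for n
  define M where "M n = 8 * n + 4 + W n" for n
  have "(\<lambda>n. real (T n)) \<in> O(\<lambda>n. real n * ln (real n))"
    \<comment> \<open>These instances of \<open>of_nat_add\<close> split only the three-term sum and
      keep \<open>5 * d + 46\<close> as one constant coefficient.\<close>
    unfolding T_def of_nat_add[of "_ + _ * _"] of_nat_add[of "6 * _"] of_nat_mult
    using fft_ops linear_in_bigo_linearithmic
      landau_o.big_trans[OF const_in_bigo_linear linear_in_bigo_linearithmic]
    by (intro sum_in_bigo) (simp_all add: landau_o.big.cmult_in_iff)
  moreover have "(\<lambda>n. real (M n)) \<in> O(\<lambda>n. real n)"
    unfolding M_def of_nat_add of_nat_mult
    by (intro sum_in_bigo fft_workspace const_in_bigo_linear) simp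
  moreover have "ops F (Ng ns) (precond_solve ns) \<le> T (Ng ns)"
      "storage W (Ng ns) (precond_solve ns) \<le> M (Ng ns)" "\<forall>n\<in>set ns. 0 < n"
    if "periodic_grid d ns Ls" for ns Ls
    using that storage_precond_solve[of W ns]
    by (auto simp: T_def M_def ops_precond_solve periodic_grid_def)
  ultimately show ?global
    by (intro exI[of _ T] exI[of _ M] conjI allI impI precond_solve_correct)
qed

end
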